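(* Let $B$ be a finite Blaschke product of degree $N$ with distinct zeros $a_1,\dots,a_N$. For $n=1,\dots,N$ let $B_n(z)=\prod_{j=1}^n\frac{z-a_j}{1-\bar a_jz}$, $C_n=C_{B_n}$, and let $P_n$ be the orthogonal projection of $K^2_B$ onto $K^2_{B_n}$. Let $A$ be a linear operator on $K^2_B$. The following are equivalent: (1) $A\in\mathcal{T}(B)$; (2) for every nonconstant Blaschke product $B_\sigma$ dividing $B$, the operator $A_\sigma=P_{B_\sigma}A|_{K^2_{B_\sigma}}$ is $C_{B_\sigma}$--symmetric; (3) for every $n=1,\dots,N$, the operator $A_n=P_nA|_{K^2_{B_n}}$ is $C_n$--symmetric.
   Context: $B(z)=e^{i\gamma}\prod_{j=1}^N\frac{z-a_j}{1-\bar a_jz}$, $\gamma\in\mathbb{R}$. For an inner function $\theta$: $K^2_\theta=H^2\ominus\theta H^2$, $P_\theta$ the orthogonal projection onto $K^2_\theta$, $C_\theta f(z)=\theta(z)\overline{zf(z)}$ on $|z|=1$; an operator $T$ on $K^2_\theta$ is $C_\theta$--symmetric if $C_\theta TC_\theta=T^*$. An inner $\alpha$ divides $\theta$ if $\bar\alpha\theta$ is inner (then $K^2_\alpha\subset K^2_\theta$). For $\varphi\in L^2$, $A^\theta_\varphi f=P_\theta(\varphi f)$ on $\{f\in K^2_\theta:\varphi f\in L^2\}$; $\mathcal{T}(\theta)$ is the set of bounded such operators (truncated Toeplitz operators). *)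

theory Defs
  imports "HOL-Analysis.Analysis"
begin

text \<open>Functions on the unit circle are represented by functions
  complex => complex, evaluated at cis t, t in [0, 2 pi].  L2, H2 etc. are
  sets of such functions; elements equal almost everywhere are identified
  via l2eq.\<close>

definition L2 :: "(complex \<Rightarrow> complex) set" where
  "L2 = {f. (\<lambda>t. f (cis t)) measurable_on {0..2*pi} \<and>
            (\<lambda>t. (cmod (f (cis t)))^2) integrable_on {0..2*pi}}"

definition ipr :: "(complex \<Rightarrow> complex) \<Rightarrow> (complex \<Rightarrow> complex) \<Rightarrow> complex" where
  "ipr f g = integral {0..2*pi} (\<lambda>t. f (cis t) * cnj (g (cis t))) / (2 * pi)"

definition l2norm :: "(complex \<Rightarrow> complex) \<Rightarrow> real" where
  "l2norm f = sqrt (integral {0..2*pi} (\<lambda>t. (cmod (f (cis t)))^2) / (2 * pi))"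

definition l2eq :: "(complex \<Rightarrow> complex) \<Rightarrow> (complex \<Rightarrow> complex) \<Rightarrow> bool" where
  "l2eq f g \<longleftrightarrow> l2norm (\<lambda>z. f z - g z) = 0"

definition fourier :: "(complex \<Rightarrow> complex) \<Rightarrow> int \<Rightarrow> complex" where
  "fourier f n = integral {0..2*pi} (\<lambda>t. f (cis t) * cis (- (of_int n * t))) / (2 * pi)"

definition H2 :: "(complex \<Rightarrow> complex) set" where
  "H2 = {f. f \<in> L2 \<and> (\<forall>n::int. n < 0 \<longrightarrow> fourier f n = 0)}"

definition is_inner :: "(complex \<Rightarrow> complex) \<Rightarrow> bool" where
  "is_inner \<theta> \<longleftrightarrow> \<theta> \<in> H2 \<and>
     (AE t in lebesgue_on {0..2*pi}. cmod (\<theta> (cis t)) = 1)"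

definition divides_inner :: "(complex \<Rightarrow> complex) \<Rightarrow> (complex \<Rightarrow> complex) \<Rightarrow> bool" where
  "divides_inner \<alpha> \<theta> \<longleftrightarrow> is_inner (\<lambda>z. cnj (\<alpha> z) * \<theta> z)"

definition K2 :: "(complex \<Rightarrow> complex) \<Rightarrow> (complex \<Rightarrow> complex) set" where
  "K2 \<theta> = {f. f \<in> H2 \<and> (\<forall>h\<in>H2. ipr f (\<lambda>z. \<theta> z * h z) = 0)}"

definition proj_onto :: "(complex \<Rightarrow> complex) set \<Rightarrow> (complex \<Rightarrow> complex) \<Rightarrow> (complex \<Rightarrow> complex)" where
  "proj_onto K f = (SOME g. g \<in> K \<and> (\<forall>h\<in>K. ipr (\<lambda>z. f z - g z) h = 0))"

definition Pth :: "(complex \<Rightarrow> complex) \<Rightarrow> (complex \<Rightarrow> complex) \<Rightarrow> (complex \<Rightarrow> complex)" where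
  "Pth \<theta> = proj_onto (K2 \<theta>)"

definition Cth :: "(complex \<Rightarrow> complex) \<Rightarrow> (complex \<Rightarrow> complex) \<Rightarrow> (complex \<Rightarrow> complex)" where
  "Cth \<theta> f = (\<lambda>z. \<theta> z * cnj (z * f z))"

definition lin_op_on :: "(complex \<Rightarrow> complex) set \<Rightarrow> ((complex \<Rightarrow> complex) \<Rightarrow> (complex \<Rightarrow> complex)) \<Rightarrow> bool" where
  "lin_op_on K A \<longleftrightarrow> (\<forall>f\<in>K. A f \<in> K) \<and>
     (\<forall>f\<in>K. \<forall>g\<in>K. l2eq f g \<longrightarrow> l2eq (A f) (A g)) \<and>
     (\<forall>f\<in>K. \<forall>g\<in>K. l2eq (A (\<lambda>z. f z + g z)) (\<lambda>z. A f z + A g z)) \<and>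
     (\<forall>c. \<forall>f\<in>K. l2eq (A (\<lambda>z. c * f z)) (\<lambda>z. c * A f z))"

definition is_adjoint_on :: "(complex \<Rightarrow> complex) set \<Rightarrow> ((complex \<Rightarrow> complex) \<Rightarrow> (complex \<Rightarrow> complex))
    \<Rightarrow> ((complex \<Rightarrow> complex) \<Rightarrow> (complex \<Rightarrow> complex)) \<Rightarrow> bool" where
  "is_adjoint_on K T S \<longleftrightarrow> (\<forall>f\<in>K. \<forall>g\<in>K. ipr (S f) g = ipr f (T g))"

definition C_symmetric :: "(complex \<Rightarrow> complex) \<Rightarrow> ((complex \<Rightarrow> complex) \<Rightarrow> (complex \<Rightarrow> complex)) \<Rightarrow> bool" where
  "C_symmetric \<theta> T \<longleftrightarrow> is_adjoint_on (K2 \<theta>) T (\<lambda>f. Cth \<theta> (T (Cth \<theta> f)))"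

definition TTO :: "(complex \<Rightarrow> complex) \<Rightarrow> ((complex \<Rightarrow> complex) \<Rightarrow> (complex \<Rightarrow> complex)) \<Rightarrow> bool" where
  "TTO \<theta> A \<longleftrightarrow> (\<exists>\<phi>. \<phi> \<in> L2 \<and>
     (\<exists>M. \<forall>f\<in>K2 \<theta>. (\<lambda>z. \<phi> z * f z) \<in> L2 \<longrightarrow>
              l2norm (Pth \<theta> (\<lambda>z. \<phi> z * f z)) \<le> M * l2norm f) \<and>
     (\<exists>M. \<forall>f\<in>K2 \<theta>. l2norm (A f) \<le> M * l2norm f) \<and>
     (\<forall>f\<in>K2 \<theta>. (\<lambda>z. \<phi> z * f z) \<in> L2 \<longrightarrow> l2eq (A f) (Pth \<theta> (\<lambda>z. \<phi> z * f z))))"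

definition blaschke :: "real \<Rightarrow> complex list \<Rightarrow> complex \<Rightarrow> complex" where
  "blaschke \<gamma> as z = cis \<gamma> * (\<Prod>a\<leftarrow>as. (z - a) / (1 - cnj a * z))"

definition is_finite_blaschke :: "(complex \<Rightarrow> complex) \<Rightarrow> bool" where
  "is_finite_blaschke b \<longleftrightarrow> (\<exists>\<gamma> as. (\<forall>a\<in>set as. cmod a < 1) \<and> b = blaschke \<gamma> as)"

definition nonconstant_on_disc :: "(complex \<Rightarrow> complex) \<Rightarrow> bool" where
  "nonconstant_on_disc b \<longleftrightarrow> \<not> (\<exists>c. \<forall>z. cmod z < 1 \<longrightarrow> b z = c)"

end

theory Submission
  imports Defs
begin

text \<open>Write \<open>k\<^sub>a(z) = 1 / (1 - cnj a * z)\<close>. If \<open>A\<close> has symbol \<open>\<phi>\<close>, then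
  \<open>\<langle>A (C f), C g\<rangle> = \<langle>A g, f\<rangle>\<close> on every \<open>K\<^sub>\<sigma>\<close>, because \<open>\<phi> (C f) cnj (C g) = \<phi> g cnj f\<close> pointwise on
  the circle; this is the \<open>C\<close>-symmetry of the compression.

  Conversely put \<open>M i l = \<langle>A k\<^sub>i, k\<^sub>l\<rangle> (1 - cnj i * l)\<close> for zeros \<open>i\<close>, \<open>l\<close>. The operator \<open>A\<close> is a
  truncated Toeplitz operator as soon as \<open>M i l = u i + v l\<close>: the symbol \<open>cnj p + q\<close> works if
  \<open>p\<close> interpolates \<open>cnj u\<close> and \<open>q\<close> interpolates \<open>v\<close> at the zeros. Expanding \<open>C\<^sub>n k\<^sub>j\<close> in partial
  fractions turns \<open>C\<^sub>n\<close>-symmetry into linear relations between rows \<open>i\<close> and \<open>j\<close> of \<open>M\<close>. Induction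
  on \<open>n\<close>: after subtracting \<open>u i + v l\<close>, the relations for two old zeros determine the new column,
  and those for the new zero and an old one kill the new row because the Cauchy matrix
  \<open>(k\<^sub>i(l))\<close> is nonsingular.\<close>

section \<open>Integration over the circle\<close>

abbreviation circ :: "real measure" where
  "circ \<equiv> lebesgue_on {0..2*pi}"

text \<open>A Bochner integral, whereas \<open>ipr\<close> and \<open>fourier\<close> are gauge
  integrals; the two agree once the integrand is known to be in \<open>L1\<close>.\<close>

definition mean :: "(complex \<Rightarrow> complex) \<Rightarrow> complex" where
  "mean f = (LINT t|circ. f (cis t)) / (2 * pi)"

definition Cmeas :: "(complex \<Rightarrow> complex) set" where
  "Cmeas = {f. (\<lambda>t. f (cis t)) \<in> borel_measurable circ}"

definition L1 :: "(complex \<Rightarrow> complex) set" where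
  "L1 = {f. integrable circ (\<lambda>t. f (cis t))}"

text \<open>A bound at every point of the circle, not only almost everywhere: kernels, Blaschke
  factors and the symbols constructed below are continuous there.\<close>

definition Linf :: "(complex \<Rightarrow> complex) set" where
  "Linf = {f. f \<in> Cmeas \<and> (\<exists>C. \<forall>z. cmod z = 1 \<longrightarrow> cmod (f z) \<le> C)}"

lemma mean_cong: "(\<And>z. cmod z = 1 \<Longrightarrow> f z = g z) \<Longrightarrow> mean f = mean g"
  by (simp add: mean_def)

text \<open>For a nonnegative integrand gauge integrability already gives Lebesgue integrability;
  this carries \<open>L2\<close> over to Bochner integration.\<close>

lemma L2_iff:
  "f \<in> L2 \<longleftrightarrow> f \<in> Cmeas \<and> integrable circ (\<lambda>t. (cmod (f (cis t)))\<^sup>2)"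
proof -
  have S: "{0..2*pi} \<in> sets lebesgue" by simp
  have "(\<lambda>t. (cmod (f (cis t)))\<^sup>2) integrable_on {0..2*pi}
     \<longleftrightarrow> integrable circ (\<lambda>t. (cmod (f (cis t)))\<^sup>2)"
  proof
    assume "(\<lambda>t. (cmod (f (cis t)))\<^sup>2) integrable_on {0..2*pi}"
    then show "integrable circ (\<lambda>t. (cmod (f (cis t)))\<^sup>2)"
      by (intro absolutely_integrable_imp_integrable nonnegative_absolutely_integrable_1) auto
  next
    assume "integrable circ (\<lambda>t. (cmod (f (cis t)))\<^sup>2)"
    then show "(\<lambda>t. (cmod (f (cis t)))\<^sup>2) integrable_on {0..2*pi}"
      using S by (rule integrable_on_lebesgue_on)
  qed
  then show ?thesis
    by (auto simp: L2_def Cmeas_def measurable_on_iff_borel_measurable[OF S])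
qed

lemma L2_imp_Cmeas: "f \<in> L2 \<Longrightarrow> f \<in> Cmeas"
  by (simp add: L2_iff)

lemma Cmeas_continuous: "continuous_on (sphere 0 1) f \<Longrightarrow> f \<in> Cmeas"
  unfolding Cmeas_def mem_Collect_eq
  by (rule continuous_imp_measurable_on_sets_lebesgue)
     (auto intro!: continuous_on_compose2[of "sphere 0 1" f] continuous_intros)

lemma Linf_continuous:
  assumes "continuous_on (sphere 0 1) f"
  shows "f \<in> Linf"
proof -
  have "compact (f ` sphere 0 1)"
    using assms by (intro compact_continuous_image) auto
  then obtain C where "\<And>w. w \<in> f ` sphere 0 1 \<Longrightarrow> cmod w \<le> C"
    using compact_imp_bounded bounded_iff by metis
  then have "\<forall>z. cmod z = 1 \<longrightarrow> cmod (f z) \<le> C" by simp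
  then show ?thesis using Cmeas_continuous[OF assms] by (auto simp: Linf_def)
qed

section \<open>Closure properties of bounded, square-integrable and integrable functions\<close>

lemma Cmeas_mult: "f \<in> Cmeas \<Longrightarrow> g \<in> Cmeas \<Longrightarrow> (\<lambda>z. f z * g z) \<in> Cmeas"
  and Cmeas_add: "f \<in> Cmeas \<Longrightarrow> g \<in> Cmeas \<Longrightarrow> (\<lambda>z. f z + g z) \<in> Cmeas"
  by (simp_all add: Cmeas_def)

lemma Cmeas_cnj: "f \<in> Cmeas \<Longrightarrow> (\<lambda>z. cnj (f z)) \<in> Cmeas"
  unfolding Cmeas_def mem_Collect_eq
  by (rule borel_measurable_continuous_on[where f=cnj]) (auto intro!: continuous_intros)

lemma Linf_cnj: "f \<in> Linf \<Longrightarrow> (\<lambda>z. cnj (f z)) \<in> Linf"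
  by (auto simp: Linf_def Cmeas_cnj)

lemma Linf_mult:
  assumes "f \<in> Linf" "g \<in> Linf" shows "(\<lambda>z. f z * g z) \<in> Linf"
proof -
  obtain C D where "\<And>z. cmod z = 1 \<Longrightarrow> cmod (f z) \<le> C" "\<And>z. cmod z = 1 \<Longrightarrow> cmod (g z) \<le> D"
    using assms by (auto simp: Linf_def)
  then have "cmod (f z * g z) \<le> C * D" if "cmod z = 1" for z
    using that unfolding norm_mult by (intro mult_mono') auto
  then show ?thesis using assms by (auto simp: Linf_def Cmeas_mult)
qed

lemma Linf_add:
  assumes "f \<in> Linf" "g \<in> Linf" shows "(\<lambda>z. f z + g z) \<in> Linf"
proof -
  obtain C D where "\<And>z. cmod z = 1 \<Longrightarrow> cmod (f z) \<le> C" "\<And>z. cmod z = 1 \<Longrightarrow> cmod (g z) \<le> D"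
    using assms by (auto simp: Linf_def)
  then have "cmod (f z + g z) \<le> C + D" if "cmod z = 1" for z
    using that by (intro norm_triangle_mono) auto
  then show ?thesis using assms by (auto simp: Linf_def Cmeas_add)
qed

lemma L2_bounded_mult:
  assumes "F \<in> Linf" "f \<in> L2" shows "(\<lambda>z. F z * f z) \<in> L2"
proof -
  obtain C where C: "\<And>z. cmod z = 1 \<Longrightarrow> cmod (F z) \<le> C" using assms by (auto simp: Linf_def)
  have M: "(\<lambda>z. F z * f z) \<in> Cmeas" using assms by (simp add: Linf_def L2_iff Cmeas_mult)
  have "integrable circ (\<lambda>t. (cmod (F (cis t) * f (cis t)))\<^sup>2)"
  proof (rule Bochner_Integration.integrable_bound)
    show "integrable circ (\<lambda>t. C\<^sup>2 * (cmod (f (cis t)))\<^sup>2)" using assms by (simp add: L2_iff)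
    show "(\<lambda>t. (cmod (F (cis t) * f (cis t)))\<^sup>2) \<in> borel_measurable circ"
      using M unfolding Cmeas_def by simp
    have "(cmod (F (cis t) * f (cis t)))\<^sup>2 \<le> C\<^sup>2 * (cmod (f (cis t)))\<^sup>2" for t
      using C[of "cis t"] by (auto simp: norm_mult power_mult_distrib intro!: mult_right_mono power_mono)
    then show "AE t in circ. norm ((cmod (F (cis t) * f (cis t)))\<^sup>2) \<le> norm (C\<^sup>2 * (cmod (f (cis t)))\<^sup>2)"
      by simp
  qed
  with M show ?thesis by (simp add: L2_iff)
qed

lemma L2_const: "(\<lambda>z. c) \<in> L2"
  by (simp add: L2_iff Cmeas_def)

lemma Linf_imp_L2: "f \<in> Linf \<Longrightarrow> f \<in> L2"
  using L2_bounded_mult[OF _ L2_const[of 1]] by simp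

lemma L2_cmult: "f \<in> L2 \<Longrightarrow> (\<lambda>z. c * f z) \<in> L2"
  by (rule L2_bounded_mult) (auto intro: Linf_continuous continuous_intros)

lemma L2_add:
  assumes "f \<in> L2" "g \<in> L2" shows "(\<lambda>z. f z + g z) \<in> L2"
proof -
  have M: "(\<lambda>z. f z + g z) \<in> Cmeas" using assms by (simp add: L2_iff Cmeas_add)
  have "integrable circ (\<lambda>t. (cmod (f (cis t) + g (cis t)))\<^sup>2)"
  proof (rule Bochner_Integration.integrable_bound)
    show "integrable circ (\<lambda>t. 2 * (cmod (f (cis t)))\<^sup>2 + 2 * (cmod (g (cis t)))\<^sup>2)"
      using assms by (simp add: L2_iff)
    show "(\<lambda>t. (cmod (f (cis t) + g (cis t)))\<^sup>2) \<in> borel_measurable circ"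
      using M unfolding Cmeas_def by simp
    have "(cmod (x + y))\<^sup>2 \<le> 2 * (cmod x)\<^sup>2 + 2 * (cmod y)\<^sup>2" for x y
    proof -
      have "(cmod (x + y))\<^sup>2 \<le> (cmod x + cmod y)\<^sup>2" by (intro power_mono norm_triangle_ineq) auto
      then show ?thesis using sum_squares_bound[of "cmod x" "cmod y"] by (simp add: power2_sum)
    qed
    then show "AE t in circ. norm ((cmod (f (cis t) + g (cis t)))\<^sup>2)
        \<le> norm (2 * (cmod (f (cis t)))\<^sup>2 + 2 * (cmod (g (cis t)))\<^sup>2)"
      by simp
  qed
  with M show ?thesis by (simp add: L2_iff)
qed

lemma L2_diff: "f \<in> L2 \<Longrightarrow> g \<in> L2 \<Longrightarrow> (\<lambda>z. f z - g z) \<in> L2"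
  using L2_add[of f "\<lambda>z. (-1) * g z"] L2_cmult[of g "-1"] by simp

lemma L2_sum: "(\<And>i. i \<in> I \<Longrightarrow> f i \<in> L2) \<Longrightarrow> (\<lambda>z. \<Sum>i\<in>I. f i z) \<in> L2"
  by (induction I rule: infinite_finite_induct) (auto simp: L2_const L2_add)

lemma L1_mult:
  assumes "f \<in> L2" "g \<in> L2" shows "(\<lambda>z. f z * g z) \<in> L1"
  unfolding L1_def mem_Collect_eq
proof (rule Bochner_Integration.integrable_bound)
  show "integrable circ (\<lambda>t. (cmod (f (cis t)))\<^sup>2 + (cmod (g (cis t)))\<^sup>2)"
    using assms by (simp add: L2_iff)
  show "(\<lambda>t. f (cis t) * g (cis t)) \<in> borel_measurable circ"
    using Cmeas_mult[OF L2_imp_Cmeas[OF assms(1)] L2_imp_Cmeas[OF assms(2)]] by (simp add: Cmeas_def)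
  have "cmod (x * y) \<le> (cmod x)\<^sup>2 + (cmod y)\<^sup>2" for x y
  proof -
    have "2 * (cmod x * cmod y) \<le> (cmod x)\<^sup>2 + (cmod y)\<^sup>2"
      using sum_squares_bound[of "cmod x" "cmod y"] by simp
    moreover have "0 \<le> cmod x * cmod y" by simp
    ultimately show ?thesis unfolding norm_mult by linarith
  qed
  then show "AE t in circ. norm (f (cis t) * g (cis t))
      \<le> norm ((cmod (f (cis t)))\<^sup>2 + (cmod (g (cis t)))\<^sup>2)"
    by simp
qed

lemma L2_cnj: "f \<in> L2 \<Longrightarrow> (\<lambda>z. cnj (f z)) \<in> L2"
  by (simp add: L2_iff Cmeas_cnj)

lemma L2_imp_L1: "f \<in> L2 \<Longrightarrow> f \<in> L1"
  using L1_mult[OF _ L2_const[of 1]] by simp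

section \<open>Means, inner products and the L2 norm\<close>

lemma mean_add: "f \<in> L1 \<Longrightarrow> g \<in> L1 \<Longrightarrow> mean (\<lambda>z. f z + g z) = mean f + mean g"
  by (simp add: L1_def mean_def add_divide_distrib)

lemma mean_diff: "f \<in> L1 \<Longrightarrow> g \<in> L1 \<Longrightarrow> mean (\<lambda>z. f z - g z) = mean f - mean g"
  by (simp add: L1_def mean_def diff_divide_distrib)

lemma mean_cmult: "mean (\<lambda>z. c * f z) = c * mean f"
  by (simp add: mean_def)

lemma mean_cnj: "mean (\<lambda>z. cnj (f z)) = cnj (mean f)"
  by (simp add: mean_def)

lemma mean_const: "mean (\<lambda>z. c) = c"
  by (simp add: mean_def measure_restrict_space scaleR_conv_of_real)

lemma ipr_cnj: "ipr g f = cnj (ipr f g)"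
  by (simp add: ipr_def Henstock_Kurzweil_Integration.integral_cnj mult.commute)

lemma ipr_eq_mean: "f \<in> L2 \<Longrightarrow> g \<in> L2 \<Longrightarrow> ipr f g = mean (\<lambda>z. f z * cnj (g z))"
  using L1_mult[OF _ L2_cnj, of f g]
  by (simp add: ipr_def mean_def L1_def lebesgue_integral_eq_integral)

lemma ipr_cong:
  assumes "\<And>z. cmod z = 1 \<Longrightarrow> f z = f' z" "\<And>z. cmod z = 1 \<Longrightarrow> g z = g' z"
  shows "ipr f g = ipr f' g'"
  using assms by (simp add: ipr_def)

lemma ipr_add_left:
  "f \<in> L2 \<Longrightarrow> g \<in> L2 \<Longrightarrow> h \<in> L2 \<Longrightarrow> ipr (\<lambda>z. f z + g z) h = ipr f h + ipr g h"
  by (simp add: ipr_eq_mean L2_add L1_mult L2_cnj distrib_right mean_add)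

lemma ipr_diff_left:
  "f \<in> L2 \<Longrightarrow> g \<in> L2 \<Longrightarrow> h \<in> L2 \<Longrightarrow> ipr (\<lambda>z. f z - g z) h = ipr f h - ipr g h"
  by (simp add: ipr_eq_mean L2_diff L1_mult L2_cnj left_diff_distrib mean_diff)

lemma ipr_cmult_left: "ipr (\<lambda>z. c * f z) g = c * ipr f g"
  by (simp add: ipr_def mult.assoc)

lemma ipr_sum_left:
  assumes "\<And>i. i \<in> I \<Longrightarrow> f i \<in> L2" "h \<in> L2"
  shows "ipr (\<lambda>z. \<Sum>i\<in>I. c i * f i z) h = (\<Sum>i\<in>I. c i * ipr (f i) h)"
  using assms
proof (induction I rule: infinite_finite_induct)
  case (insert i I)
  then show ?case
    by (simp add: ipr_add_left ipr_cmult_left L2_sum L2_cmult)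
qed (simp_all add: ipr_def)

lemma ipr_sum_right:
  assumes "\<And>i. i \<in> I \<Longrightarrow> f i \<in> L2" "h \<in> L2"
  shows "ipr h (\<lambda>z. \<Sum>i\<in>I. c i * f i z) = (\<Sum>i\<in>I. cnj (c i) * ipr h (f i))"
  using ipr_sum_left[of I f h c] assms
  by (simp add: ipr_cnj[of h] del: complex_cnj_cnj)

lemma l2norm_eq:
  "f \<in> L2 \<Longrightarrow> l2norm f = sqrt ((LINT t|circ. (cmod (f (cis t)))\<^sup>2) / (2 * pi))"
  by (simp add: l2norm_def L2_iff lebesgue_integral_eq_integral)

lemma l2norm_nonneg: "f \<in> L2 \<Longrightarrow> l2norm f \<ge> 0"
  by (auto simp: l2norm_eq intro!: divide_nonneg_nonneg Bochner_Integration.integral_nonneg)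

lemma ipr_self:
  assumes "f \<in> L2" shows "ipr f f = complex_of_real ((l2norm f)\<^sup>2)"
proof -
  have "mean (\<lambda>z. f z * cnj (f z)) = complex_of_real ((LINT t|circ. (cmod (f (cis t)))\<^sup>2) / (2 * pi))"
    unfolding mean_def by (simp add: complex_norm_square[symmetric] of_real_power[symmetric] del: of_real_power)
  moreover have "(LINT t|circ. (cmod (f (cis t)))\<^sup>2) / (2 * pi) \<ge> 0"
    by (intro divide_nonneg_nonneg Bochner_Integration.integral_nonneg) auto
  ultimately show ?thesis using assms by (simp add: l2norm_eq ipr_eq_mean)
qed

lemma l2norm_eq_0_iff_AE:
  assumes "f \<in> L2" shows "l2norm f = 0 \<longleftrightarrow> (AE t in circ. f (cis t) = 0)"
proof -
  have "(LINT t|circ. (cmod (f (cis t)))\<^sup>2) = 0 \<longleftrightarrow> (AE t in circ. (cmod (f (cis t)))\<^sup>2 = 0)"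
    using assms by (intro integral_nonneg_eq_0_iff_AE) (auto simp: L2_iff)
  then show ?thesis using assms by (simp add: l2norm_eq)
qed

lemma l2eq_iff_AE:
  "f \<in> L2 \<Longrightarrow> g \<in> L2 \<Longrightarrow> l2eq f g \<longleftrightarrow> (AE t in circ. f (cis t) = g (cis t))"
  by (simp add: l2eq_def l2norm_eq_0_iff_AE L2_diff)

lemma ipr_l2eq:
  assumes "l2eq f g" "f \<in> L2" "g \<in> L2" "h \<in> L2" shows "ipr f h = ipr g h"
proof -
  have ae: "AE t in circ. f (cis t) = g (cis t)" using assms l2eq_iff_AE by blast
  have "mean (\<lambda>z. f z * cnj (h z)) = mean (\<lambda>z. g z * cnj (h z))"
    unfolding mean_def
    using ae L1_mult[OF assms(2) L2_cnj[OF assms(4)]] L1_mult[OF assms(3) L2_cnj[OF assms(4)]]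
    by (subst integral_cong_AE[of _ circ]) (auto simp: L1_def)
  then show ?thesis using assms by (simp add: ipr_eq_mean)
qed

lemma l2norm_l2eq:
  assumes "l2eq f g" "f \<in> L2" "g \<in> L2" shows "l2norm f = l2norm g"
proof -
  have "ipr f f = ipr g g"
    using ipr_l2eq[OF assms assms(2)] ipr_l2eq[OF assms assms(3)] ipr_cnj[of f g] ipr_cnj[of g g]
    by (metis ipr_cnj)
  then have "(l2norm f)\<^sup>2 = (l2norm g)\<^sup>2"
    using assms by (simp add: ipr_self del: of_real_power)
  moreover have "l2norm f \<ge> 0" "l2norm g \<ge> 0"
    using assms by (simp_all add: l2norm_nonneg)
  ultimately show ?thesis by simp
qed

lemma l2eq_on_circle: "(\<And>z. cmod z = 1 \<Longrightarrow> f z = g z) \<Longrightarrow> l2eq f g"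
  by (simp add: l2eq_def l2norm_def)

lemma L2_cong: "(\<And>z. cmod z = 1 \<Longrightarrow> f z = g z) \<Longrightarrow> f \<in> L2 \<longleftrightarrow> g \<in> L2"
  by (simp add: L2_def)

section \<open>The Hardy space and its point evaluations\<close>

text \<open>The Szego kernel, reproducing for \<open>H2\<close>; the function
  \<open>k\<^sub>a\<close> of the overview.\<close>

definition szego :: "complex \<Rightarrow> complex \<Rightarrow> complex" where
  "szego a z = 1 / (1 - cnj a * z)"

definition blaschke_factor :: "complex \<Rightarrow> complex \<Rightarrow> complex" where
  "blaschke_factor a z = (z - a) / (1 - cnj a * z)"

text \<open>The value at \<open>a\<close> of the analytic extension of \<open>f\<close> to the disc.
  Functions in \<open>H2\<close> are determined only on the circle, so \<open>f a\<close> itself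
  carries no information.\<close>

definition ev :: "complex \<Rightarrow> (complex \<Rightarrow> complex) \<Rightarrow> complex" where
  "ev a f = mean (\<lambda>z. f z * cnj (szego a z))"

lemma szego_denom_nonzero: "cmod a < 1 \<Longrightarrow> cmod z \<le> 1 \<Longrightarrow> 1 - cnj a * z \<noteq> 0"
proof
  assume "cmod a < 1" "cmod z \<le> 1" "1 - cnj a * z = 0"
  then have "cmod a * cmod z = 1" by (metis complex_mod_cnj eq_iff_diff_eq_0 norm_mult norm_one)
  moreover have "cmod a * cmod z \<le> cmod a" using \<open>cmod z \<le> 1\<close> by (simp add: mult_left_le)
  ultimately show False using \<open>cmod a < 1\<close> by simp
qed

lemma szego_denom_nonzero': "cmod a < 1 \<Longrightarrow> cmod z \<le> 1 \<Longrightarrow> 1 - a * cnj z \<noteq> 0"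
  using szego_denom_nonzero[of a z] by (metis complex_cnj_cancel_iff complex_cnj_cnj complex_cnj_diff
      complex_cnj_mult complex_cnj_one complex_cnj_zero)

lemma unit_mult_cnj: "cmod z = 1 \<Longrightarrow> z * cnj z = 1" "cmod z = 1 \<Longrightarrow> cnj z * z = 1"
  by (simp_all add: complex_norm_square[symmetric] mult.commute[of "cnj z"])

text \<open>On the circle \<open>cnj z = 1 / z\<close>, so the conjugated kernel becomes the Cauchy
  kernel \<open>z / (z - a)\<close>.\<close>

lemma szego_boundary:
  assumes "cmod a < 1" "cmod z = 1"
  shows "(z - a) * cnj (szego a z) = z"
proof -
  have "z - a = z * (1 - a * cnj z)" using unit_mult_cnj[OF assms(2)] by (simp add: algebra_simps)
  moreover have "1 - a * cnj z \<noteq> 0" using szego_denom_nonzero' assms by simp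
  ultimately show ?thesis by (simp add: szego_def)
qed

lemma Linf_szego: "cmod a < 1 \<Longrightarrow> szego a \<in> Linf"
  unfolding szego_def[abs_def]
  by (rule Linf_continuous) (use szego_denom_nonzero in \<open>fastforce intro!: continuous_intros\<close>)

lemma Linf_id: "(\<lambda>z. z) \<in> Linf"
  by (rule Linf_continuous) (auto intro!: continuous_intros)

lemma Linf_const: "(\<lambda>z. c) \<in> Linf"
  by (rule Linf_continuous) (auto intro!: continuous_intros)

lemma Linf_power: "(\<lambda>z. z ^ m) \<in> Linf"
  by (rule Linf_continuous) (auto intro!: continuous_intros)

lemma L2_szego: "cmod a < 1 \<Longrightarrow> szego a \<in> L2"
  by (simp add: Linf_szego Linf_imp_L2)

lemma L1_bounded_mult: "F \<in> Linf \<Longrightarrow> f \<in> L2 \<Longrightarrow> (\<lambda>z. F z * f z) \<in> L1"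
  by (simp add: L2_bounded_mult L2_imp_L1)

lemma fourier_neg:
  assumes "f \<in> L2"
  shows "fourier f (- int (Suc m)) = mean (\<lambda>z. z ^ Suc m * f z)"
proof -
  have "cis (- (of_int (- int (Suc m)) * t)) = cis t ^ Suc m" for t
    by (simp add: Complex.DeMoivre algebra_simps del: power_Suc)
  moreover have "integrable circ (\<lambda>t. cis t ^ Suc m * f (cis t))"
    using L1_bounded_mult[OF Linf_power assms, of "Suc m"] by (simp only: L1_def mem_Collect_eq)
  ultimately show ?thesis
    unfolding fourier_def mean_def
    by (simp add: lebesgue_integral_eq_integral mult.commute del: power_Suc)
qed

lemma H2_iff: "f \<in> H2 \<longleftrightarrow> f \<in> L2 \<and> (\<forall>m. mean (\<lambda>z. z ^ Suc m * f z) = 0)"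
proof -
  have "(\<forall>n::int. n < 0 \<longrightarrow> fourier f n = 0) \<longleftrightarrow> (\<forall>m. fourier f (- int (Suc m)) = 0)"
    by (metis negD negative_zless_0)
  then show ?thesis unfolding H2_def using fourier_neg by auto
qed

lemma H2_imp_L2: "f \<in> H2 \<Longrightarrow> f \<in> L2"
  by (simp add: H2_iff)

lemma H2_cong:
  assumes "\<And>z. cmod z = 1 \<Longrightarrow> f z = g z" shows "f \<in> H2 \<longleftrightarrow> g \<in> H2"
  using L2_cong[OF assms] mean_cong[of "\<lambda>z. z ^ Suc m * f z" "\<lambda>z. z ^ Suc m * g z" for m] assms
  by (simp add: H2_iff)

lemma H2_add:
  assumes "f \<in> H2" "g \<in> H2" shows "(\<lambda>z. f z + g z) \<in> H2"
  using assms mean_add[OF L1_bounded_mult[OF Linf_power H2_imp_L2[OF assms(1)]]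
      L1_bounded_mult[OF Linf_power H2_imp_L2[OF assms(2)]]]
  by (simp add: H2_iff L2_add distrib_left del: power_Suc)

lemma H2_cmult:
  assumes "f \<in> H2" shows "(\<lambda>z. c * f z) \<in> H2"
  using assms mean_cmult[of c "\<lambda>z. z ^ Suc m * f z" for m]
  by (simp add: H2_iff L2_cmult mult.left_commute del: power_Suc)

lemma H2_diff: "f \<in> H2 \<Longrightarrow> g \<in> H2 \<Longrightarrow> (\<lambda>z. f z - g z) \<in> H2"
  using H2_add[of f "\<lambda>z. (-1) * g z"] H2_cmult[of g "-1"] by simp

lemma H2_id_mult:
  assumes "f \<in> H2" shows "(\<lambda>z. z * f z) \<in> H2"
proof -
  have "mean (\<lambda>z. z ^ Suc m * (z * f z)) = 0" for m
    using assms unfolding H2_iff mult.assoc[symmetric] power_Suc2[symmetric] by blast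
  then show ?thesis using assms L2_bounded_mult[OF Linf_id] by (simp add: H2_iff)
qed

text \<open>One step of the geometric series:
  \<open>szego a z = 1 + cnj a * z * szego a z\<close>.\<close>

lemma mean_szego_expand:
  assumes "cmod a < 1" "f \<in> L2"
  shows "mean (\<lambda>z. z ^ m * (szego a z * f z))
       = mean (\<lambda>z. z ^ m * f z) + cnj a * mean (\<lambda>z. z ^ Suc m * (szego a z * f z))"
proof -
  have "mean (\<lambda>z. z ^ m * (szego a z * f z))
      = mean (\<lambda>z. z ^ m * f z + cnj a * (z ^ Suc m * (szego a z * f z)))"
    using szego_denom_nonzero[OF assms(1)]
    by (intro mean_cong) (simp add: szego_def field_simps)
  also have "\<dots> = mean (\<lambda>z. z ^ m * f z) + mean (\<lambda>z. cnj a * (z ^ Suc m * (szego a z * f z)))"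
    by (intro mean_add L2_imp_L1 L2_cmult L2_bounded_mult[OF Linf_power]
        L2_bounded_mult[OF Linf_szego] assms)
  finally show ?thesis by (simp add: mean_cmult)
qed

text \<open>The negative moments satisfy \<open>I m = cnj a * I (Suc m)\<close> and are bounded
  uniformly in \<open>m\<close>, so \<open>cmod (I m) \<le> cmod a ^ j * C\<close> for every
  \<open>j\<close>, and the right side tends to 0.\<close>

lemma H2_szego_mult:
  assumes a: "cmod a < 1" and f: "f \<in> H2" shows "(\<lambda>z. szego a z * f z) \<in> H2"
proof -
  define I where "I m = mean (\<lambda>z. z ^ Suc m * (szego a z * f z))" for m
  have L: "(\<lambda>z. szego a z * f z) \<in> L2"
    using a f L2_bounded_mult[OF Linf_szego] by (simp add: H2_iff)
  define C where "C = (LINT t|circ. cmod (szego a (cis t) * f (cis t))) / (2 * pi)"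
  have bound: "cmod (I m) \<le> C" for m
  proof -
    have "cmod (LINT t|circ. cis t ^ Suc m * (szego a (cis t) * f (cis t)))
        \<le> (LINT t|circ. cmod (cis t ^ Suc m * (szego a (cis t) * f (cis t))))"
      by (rule Bochner_Integration.integral_norm_bound)
    also have "\<dots> = (LINT t|circ. cmod (szego a (cis t) * f (cis t)))"
      by (simp add: norm_mult norm_power)
    finally show ?thesis
      unfolding I_def mean_def C_def by (simp add: norm_divide divide_right_mono del: power_Suc)
  qed
  have step: "I m = cnj a * I (Suc m)" for m
    using mean_szego_expand[OF a H2_imp_L2[OF f], of "Suc m"] f by (simp add: I_def H2_iff del: power_Suc)
  have iter: "I m = cnj a ^ j * I (m + j)" for m j
  proof (induction j)
    case (Suc j)
    then show ?case using step[of "m + j"] by (simp add: mult_ac)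
  qed simp
  have "I m = 0" for m
  proof -
    have le: "cmod (I m) \<le> cmod a ^ j * C" for j
      using iter[of m j] bound[of "m + j"]
      by (metis complex_mod_cnj mult_left_mono norm_ge_zero norm_mult norm_power zero_le_power)
    have "(\<lambda>j. cmod a ^ j * C) \<longlonglongrightarrow> 0 * C"
      using a by (intro tendsto_intros LIMSEQ_realpow_zero) auto
    then have "cmod (I m) \<le> 0"
      using le by (intro LIMSEQ_le_const[of "\<lambda>j. cmod a ^ j * C"]) auto
    then show ?thesis by simp
  qed
  with L show ?thesis unfolding I_def by (simp add: H2_iff)
qed

text \<open>The primitive of \<open>cis t ^ Suc m\<close> is periodic, so positive powers of
  \<open>z\<close> have mean 0.\<close>

lemma H2_const: "(\<lambda>z. c) \<in> H2"
proof -
  have "mean (\<lambda>z. z ^ Suc m) = 0" for m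
  proof -
    have "((\<lambda>t. cis t ^ Suc m) has_integral
        (cis (2*pi) ^ Suc m - cis 0 ^ Suc m) / (\<i> * of_nat (Suc m))) {0..2*pi}"
    proof -
      have "((\<lambda>t. cis t ^ Suc m) has_integral
          (cis (2*pi) ^ Suc m / (\<i> * of_nat (Suc m)) - cis 0 ^ Suc m / (\<i> * of_nat (Suc m)))) {0..2*pi}"
      proof (rule fundamental_theorem_of_calculus)
        fix t :: real
        have "((\<lambda>w. exp (\<i> * of_nat (Suc m) * w) / (\<i> * of_nat (Suc m))) has_field_derivative
            exp (\<i> * of_nat (Suc m) * of_real t)) (at (of_real t))"
          by (auto intro!: derivative_eq_intros simp del: of_nat_Suc)
        then have "((\<lambda>t. exp (\<i> * of_nat (Suc m) * of_real t) / (\<i> * of_nat (Suc m)))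
            has_vector_derivative exp (\<i> * of_nat (Suc m) * of_real t)) (at t within {0..2*pi})"
          by (rule has_vector_derivative_real_field)
        moreover have "cis t ^ Suc m = exp (\<i> * of_nat (Suc m) * of_real t)" for t
          unfolding Complex.DeMoivre unfolding cis_conv_exp by (simp add: mult_ac)
        ultimately show "((\<lambda>t. cis t ^ Suc m / (\<i> * of_nat (Suc m))) has_vector_derivative cis t ^ Suc m)
            (at t within {0..2*pi})"
          by simp
      qed simp
      then show ?thesis by (simp add: diff_divide_distrib)
    qed
    then have "integral {0..2*pi} (\<lambda>t. cis t ^ Suc m) = 0"
      by (auto dest!: integral_unique)
    moreover have "(\<lambda>z. z ^ Suc m) \<in> L1" by (intro L2_imp_L1 Linf_imp_L2 Linf_power)
    ultimately show ?thesis by (simp add: mean_def L1_def lebesgue_integral_eq_integral del: power_Suc)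
  qed
  then show ?thesis
    using mean_cmult[of c "\<lambda>z. z ^ Suc m" for m]
    by (simp add: H2_iff L2_const mult.commute[of c] del: power_Suc)
qed

lemma H2_szego: "cmod a < 1 \<Longrightarrow> szego a \<in> H2"
  using H2_szego_mult[OF _ H2_const[of 1]] by simp

section \<open>Point evaluations in the disc\<close>

lemma ev_eq_ipr: "cmod a < 1 \<Longrightarrow> f \<in> L2 \<Longrightarrow> ev a f = ipr f (szego a)"
  by (simp add: ev_def ipr_eq_mean L2_szego)

lemma ev_cong: "(\<And>z. cmod z = 1 \<Longrightarrow> f z = g z) \<Longrightarrow> ev a f = ev a g"
  unfolding ev_def by (rule mean_cong) simp

lemma ev_add:
  "cmod a < 1 \<Longrightarrow> f \<in> L2 \<Longrightarrow> g \<in> L2 \<Longrightarrow> ev a (\<lambda>z. f z + g z) = ev a f + ev a g"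
  by (simp add: ev_eq_ipr L2_add L2_szego ipr_add_left)

lemma ev_diff:
  "cmod a < 1 \<Longrightarrow> f \<in> L2 \<Longrightarrow> g \<in> L2 \<Longrightarrow> ev a (\<lambda>z. f z - g z) = ev a f - ev a g"
  by (simp add: ev_eq_ipr L2_diff L2_szego ipr_diff_left)

lemma ev_cmult: "ev a (\<lambda>z. c * f z) = c * ev a f"
  by (simp add: ev_def mult.assoc mean_cmult)

lemma ev_const: 
  assumes "cmod a < 1" shows "ev a (\<lambda>z. c) = c"
proof -
  \<comment> \<open>This is the remainder in the geometric expansion at \<open>m = 0\<close>; it
    vanishes since the kernel lies in \<open>H2\<close>, which leaves mean 1.\<close>
  have "mean (\<lambda>z. z ^ Suc 0 * szego a z) = 0" 
    using H2_szego[OF assms] unfolding H2_iff by blast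
  then have "mean (szego a) = 1"
    using mean_szego_expand[OF assms L2_const[of 1], of 0] by (simp add: mean_const)
  then show ?thesis by (simp add: ev_def mean_cmult mean_cnj)
qed

text \<open>By \<open>szego_boundary\<close> the difference of the two sides is the mean of
  \<open>z * f z\<close>, a negative Fourier coefficient of \<open>f\<close>.\<close>

lemma ev_id_mult:
  assumes a: "cmod a < 1" and f: "f \<in> H2" shows "ev a (\<lambda>z. z * f z) = a * ev a f"
proof -
  have L: "f \<in> L2" "(\<lambda>z. z * f z) \<in> L2" using f H2_id_mult H2_imp_L2 by auto
  have "ev a (\<lambda>z. z * f z) - a * ev a f = ev a (\<lambda>z. z * f z - a * f z)"
    using L a by (simp add: ev_diff L2_cmult ev_cmult)
  also have "\<dots> = mean (\<lambda>z. z ^ Suc 0 * f z)"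
    unfolding ev_def
  proof (rule mean_cong)
    fix z :: complex assume z: "cmod z = 1"
    have "(z - a) * cnj (szego a z) = z" using a z by (rule szego_boundary)
    then show "(z * f z - a * f z) * cnj (szego a z) = z ^ Suc 0 * f z"
      by (metis left_diff_distrib mult.commute mult.left_commute power_Suc0_right power_one_right)
  qed
  also have "\<dots> = 0" using f unfolding H2_iff by blast
  finally show ?thesis by simp
qed

lemma ev_linear_mult:
  assumes a: "cmod a < 1" and f: "f \<in> H2"
  shows "ev a (\<lambda>z. (c + d * z) * f z) = (c + d * a) * ev a f"
proof -
  have "ev a (\<lambda>z. (c + d * z) * f z) = ev a (\<lambda>z. c * f z + d * (z * f z))"
    by (simp add: algebra_simps)
  also have "\<dots> = c * ev a f + d * (a * ev a f)"
    using a f by (simp add: ev_add ev_cmult ev_id_mult L2_cmult H2_imp_L2 H2_id_mult)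
  finally show ?thesis by (simp add: algebra_simps)
qed

lemma H2_linear_mult: "f \<in> H2 \<Longrightarrow> (\<lambda>z. (c + d * z) * f z) \<in> H2"
  using H2_add[OF H2_cmult[of f c] H2_cmult[OF H2_id_mult[of f], of d]] by (simp add: algebra_simps)

lemma H2_power_mult: "f \<in> H2 \<Longrightarrow> (\<lambda>z. z ^ m * f z) \<in> H2"
  by (induction m) (simp_all add: H2_id_mult mult.assoc)

lemma ev_power_mult: "cmod a < 1 \<Longrightarrow> f \<in> H2 \<Longrightarrow> ev a (\<lambda>z. z ^ m * f z) = a ^ m * ev a f"
  by (induction m) (simp_all add: ev_id_mult H2_power_mult mult.assoc)

text \<open>Multiplying back by \<open>1 - cnj a * z\<close>, whose effect under \<open>ev b\<close>
  is already known, recovers \<open>f\<close>; this factor is nonzero at \<open>b\<close>.\<close>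

lemma ev_szego_mult:
  assumes "cmod a < 1" "cmod b < 1" "f \<in> H2"
  shows "ev b (\<lambda>z. szego a z * f z) = szego a b * ev b f"
proof -
  have "ev b f = ev b (\<lambda>z. (1 + (- cnj a) * z) * (szego a z * f z))"
    using szego_denom_nonzero[OF assms(1)] by (intro ev_cong) (simp add: szego_def)
  also have "\<dots> = (1 + (- cnj a) * b) * ev b (\<lambda>z. szego a z * f z)"
    by (intro ev_linear_mult H2_szego_mult assms)
  finally show ?thesis using szego_denom_nonzero[OF assms(1), of b] assms(2)
    by (simp add: szego_def field_simps)
qed

section \<open>Multiplication and division by one Blaschke factor\<close>

lemma blaschke_factor_eq: "blaschke_factor a z = ((- a) + 1 * z) * szego a z"
  by (simp add: blaschke_factor_def szego_def)

text \<open>Turns division by a Blaschke factor on the circle into evaluation at its zero: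
  \<open>cnj (szego a z)\<close> is the weight that defines \<open>ev a\<close>.\<close>

lemma cnj_blaschke_factor:
  assumes "cmod a < 1" "cmod z = 1"
  shows "z * cnj (blaschke_factor a z) = (1 + (- cnj a) * z) * cnj (szego a z)"
proof -
  have "z * (cnj z - cnj a) = 1 - cnj a * z" using unit_mult_cnj[OF assms(2)] by (simp add: algebra_simps)
  then show ?thesis by (simp add: blaschke_factor_def szego_def)
qed

lemma blaschke_factor_unit:
  assumes "cmod a < 1" "cmod z = 1"
  shows "blaschke_factor a z * cnj (blaschke_factor a z) = 1"
proof -
  have "z * (blaschke_factor a z * cnj (blaschke_factor a z)) = blaschke_factor a z * ((1 + (- cnj a) * z) * cnj (szego a z))"
    using cnj_blaschke_factor[OF assms] by (metis mult.left_commute)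
  also have "\<dots> = (z - a) * cnj (szego a z)"
    using szego_denom_nonzero[OF assms(1), of z] assms(2) by (simp add: blaschke_factor_def)
  also have "\<dots> = z" using assms by (rule szego_boundary)
  finally show ?thesis using assms(2) by (metis mult_cancel_left1 norm_zero zero_neq_one mult.right_neutral)
qed

lemma H2_blaschke_factor_mult: "cmod a < 1 \<Longrightarrow> f \<in> H2 \<Longrightarrow> (\<lambda>z. blaschke_factor a z * f z) \<in> H2"
  unfolding blaschke_factor_eq mult.assoc by (intro H2_linear_mult H2_szego_mult)

lemma ev_blaschke_factor_mult:
  "cmod a < 1 \<Longrightarrow> cmod b < 1 \<Longrightarrow> f \<in> H2 \<Longrightarrow> ev b (\<lambda>z. blaschke_factor a z * f z) = blaschke_factor a b * ev b f"
  unfolding blaschke_factor_eq mult.assoc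
  by (simp only: ev_linear_mult H2_szego_mult ev_szego_mult)

lemma Linf_blaschke_factor: "cmod a < 1 \<Longrightarrow> blaschke_factor a \<in> Linf"
  unfolding blaschke_factor_def[abs_def]
  by (rule Linf_continuous) (use szego_denom_nonzero in \<open>fastforce intro!: continuous_intros\<close>)

text \<open>The negative moments of the quotient are values at \<open>a\<close> of a polynomial
  times \<open>g\<close>, so they all contain the factor \<open>ev a g\<close>.\<close>

lemma H2_divide_blaschke_factor:
  assumes a: "cmod a < 1" and g: "g \<in> H2" "ev a g = 0"
  shows "(\<lambda>z. cnj (blaschke_factor a z) * g z) \<in> H2"
proof -
  have "mean (\<lambda>z. z ^ Suc m * (cnj (blaschke_factor a z) * g z)) = 0" for m
  proof -
    have "mean (\<lambda>z. z ^ Suc m * (cnj (blaschke_factor a z) * g z))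
        = ev a (\<lambda>z. z ^ m * ((1 + (- cnj a) * z) * g z))"
      unfolding ev_def
    proof (rule mean_cong)
      fix z :: complex assume "cmod z = 1"
      then have "z ^ m * (z * cnj (blaschke_factor a z)) * g z
          = z ^ m * ((1 + (- cnj a) * z) * cnj (szego a z)) * g z"
        using cnj_blaschke_factor[OF a] by simp
      then show "z ^ Suc m * (cnj (blaschke_factor a z) * g z)
          = z ^ m * ((1 + (- cnj a) * z) * g z) * cnj (szego a z)"
        by (simp add: mult_ac)
    qed
    also have "\<dots> = 0"
      using a g by (simp only: ev_power_mult ev_linear_mult H2_linear_mult) simp
    finally show ?thesis .
  qed
  then show ?thesis
    using L2_bounded_mult[OF Linf_cnj[OF Linf_blaschke_factor[OF a]]] g by (simp add: H2_iff)
qed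

text \<open>These stand in for the bounded analytic functions on the disc, described on the circle
  alone through their action on \<open>H2\<close>.\<close>

definition Mult :: "(complex \<Rightarrow> complex) set" where
  "Mult = {F. F \<in> Linf \<and> (\<forall>f\<in>H2. (\<lambda>z. F z * f z) \<in> H2)}"

lemma Mult_H2: "F \<in> Mult \<Longrightarrow> f \<in> H2 \<Longrightarrow> (\<lambda>z. F z * f z) \<in> H2"
  by (simp add: Mult_def)

lemma Mult_imp_H2: "F \<in> Mult \<Longrightarrow> F \<in> H2"
  using Mult_H2[OF _ H2_const[of 1]] by simp

lemma Mult_const: "(\<lambda>z. c) \<in> Mult"
  by (simp add: Mult_def Linf_const H2_cmult)

lemma Mult_blaschke_factor: "cmod a < 1 \<Longrightarrow> blaschke_factor a \<in> Mult"
  by (simp add: Mult_def Linf_blaschke_factor H2_blaschke_factor_mult)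

lemma Mult_mult: "F \<in> Mult \<Longrightarrow> G \<in> Mult \<Longrightarrow> (\<lambda>z. F z * G z) \<in> Mult"
  by (simp add: Mult_def Linf_mult mult.assoc)

text \<open>A function vanishing at \<open>a\<close> is divisible by \<open>blaschke_factor a\<close>, so the kernel of \<open>ev a\<close> is
  invariant under every multiplier.\<close>

lemma ev_Mult:
  assumes a: "cmod a < 1" and F: "F \<in> Mult" and f: "f \<in> H2"
  shows "ev a (\<lambda>z. F z * f z) = ev a F * ev a f"
proof -
  define c where "c = ev a f"
  define h where "h z = cnj (blaschke_factor a z) * (f z - c)" for z
  have "h \<in> H2"
    unfolding h_def
  proof (rule H2_divide_blaschke_factor[OF a])
    show "(\<lambda>z. f z - c) \<in> H2" using f H2_const by (rule H2_diff)
    show "ev a (\<lambda>z. f z - c) = 0"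
      using f a by (simp add: ev_diff H2_imp_L2 L2_const ev_const c_def)
  qed
  then have Fh: "(\<lambda>z. F z * h z) \<in> H2" using F by (simp add: Mult_H2)
  have "ev a (\<lambda>z. F z * f z) = ev a (\<lambda>z. c * F z + blaschke_factor a z * (F z * h z))"
  proof (rule ev_cong)
    fix z :: complex assume "cmod z = 1"
    then have "blaschke_factor a z * h z = f z - c"
      using blaschke_factor_unit[OF a] by (simp add: h_def mult.assoc[symmetric])
    then show "F z * f z = c * F z + blaschke_factor a z * (F z * h z)"
      by (metis add.commute diff_add_cancel distrib_left mult.commute mult.left_commute)
  qed
  also have "\<dots> = c * ev a F + blaschke_factor a a * ev a (\<lambda>z. F z * h z)"
    using a Fh F by (simp add: ev_add ev_cmult ev_blaschke_factor_mult H2_imp_L2 L2_cmult Mult_imp_H2 H2_blaschke_factor_mult)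
  finally show ?thesis by (simp add: blaschke_factor_def c_def mult.commute)
qed

section \<open>Model spaces of finite Blaschke products\<close>

text \<open>Stronger than the almost everywhere condition of \<open>is_inner\<close>: finite
  Blaschke products have modulus 1 at every point of the circle, so integrands can be compared
  pointwise.\<close>

definition unimodular :: "(complex \<Rightarrow> complex) \<Rightarrow> bool" where
  "unimodular \<theta> \<longleftrightarrow> (\<forall>z. cmod z = 1 \<longrightarrow> \<theta> z * cnj (\<theta> z) = 1)"

lemma unimodularD: "unimodular \<theta> \<Longrightarrow> cmod z = 1 \<Longrightarrow> \<theta> z * (cnj (\<theta> z) * w) = w"
  by (simp add: unimodular_def mult.assoc[symmetric])

section \<open>Finite Blaschke products\<close>

lemma blaschke_Nil: "blaschke \<gamma> [] = (\<lambda>z. cis \<gamma>)"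
  by (simp add: blaschke_def[abs_def])

lemma blaschke_Cons: "blaschke \<gamma> (a # as) = (\<lambda>z. blaschke_factor a z * blaschke \<gamma> as z)"
  by (simp add: blaschke_def[abs_def] blaschke_factor_def mult_ac)

lemma blaschke_unimodular: "\<forall>a\<in>set as. cmod a < 1 \<Longrightarrow> unimodular (blaschke \<gamma> as)"
proof (induction as)
  case Nil
  then show ?case by (simp add: blaschke_Nil unimodular_def cis_cnj cis_mult)
next
  case (Cons a as)
  show ?case unfolding unimodular_def
  proof (intro allI impI)
    fix z :: complex assume z: "cmod z = 1"
    have "blaschke \<gamma> (a # as) z * cnj (blaschke \<gamma> (a # as) z) =
      (blaschke_factor a z * cnj (blaschke_factor a z)) * (blaschke \<gamma> as z * cnj (blaschke \<gamma> as z))"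
      unfolding blaschke_Cons by (simp add: mult_ac)
    then show "blaschke \<gamma> (a # as) z * cnj (blaschke \<gamma> (a # as) z) = 1"
      using Cons z blaschke_factor_unit[of a z] by (simp add: unimodular_def)
  qed
qed

lemma Mult_blaschke: "\<forall>a\<in>set as. cmod a < 1 \<Longrightarrow> blaschke \<gamma> as \<in> Mult"
  by (induction as) (simp_all add: blaschke_Nil blaschke_Cons Mult_const Mult_mult Mult_blaschke_factor)

lemma ev_blaschke:
  "\<forall>a\<in>set as. cmod a < 1 \<Longrightarrow> cmod c < 1 \<Longrightarrow> ev c (blaschke \<gamma> as) = blaschke \<gamma> as c"
  by (induction as)
     (simp_all add: blaschke_Nil blaschke_Cons ev_const ev_blaschke_factor_mult Mult_blaschke Mult_imp_H2)

lemma blaschke_zero: "a \<in> set as \<Longrightarrow> blaschke \<gamma> as a = 0"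
  by (induction as) (auto simp: blaschke_Cons blaschke_factor_def)

section \<open>Kernels and inclusions of model spaces\<close>

lemma K2_imp_H2: "f \<in> K2 \<theta> \<Longrightarrow> f \<in> H2"
  by (simp add: K2_def)

lemma K2_imp_L2: "f \<in> K2 \<theta> \<Longrightarrow> f \<in> L2"
  by (simp add: K2_def H2_imp_L2)

lemma Mult_imp_Linf: "F \<in> Mult \<Longrightarrow> F \<in> Linf"
  by (simp add: Mult_def)

lemma K2_add: "\<theta> \<in> Mult \<Longrightarrow> f \<in> K2 \<theta> \<Longrightarrow> g \<in> K2 \<theta> \<Longrightarrow> (\<lambda>z. f z + g z) \<in> K2 \<theta>"
  by (simp add: K2_def H2_add ipr_add_left H2_imp_L2 Mult_H2)

lemma K2_cmult: "f \<in> K2 \<theta> \<Longrightarrow> (\<lambda>z. c * f z) \<in> K2 \<theta>"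
  by (simp add: K2_def H2_cmult ipr_cmult_left)

lemma K2_diff: "\<theta> \<in> Mult \<Longrightarrow> f \<in> K2 \<theta> \<Longrightarrow> g \<in> K2 \<theta> \<Longrightarrow> (\<lambda>z. f z - g z) \<in> K2 \<theta>"
  by (simp add: K2_def H2_diff ipr_diff_left H2_imp_L2 Mult_H2)

lemma K2_sum:
  "\<theta> \<in> Mult \<Longrightarrow> (\<And>i. i \<in> I \<Longrightarrow> f i \<in> K2 \<theta>) \<Longrightarrow> (\<lambda>z. \<Sum>i\<in>I. c i * f i z) \<in> K2 \<theta>"
proof (induction I rule: infinite_finite_induct)
  case (insert i I)
  then show ?case by (simp add: K2_add K2_cmult)
qed (simp_all add: K2_def H2_const ipr_def)

lemma ipr_szego: "cmod a < 1 \<Longrightarrow> f \<in> L2 \<Longrightarrow> ipr (szego a) f = cnj (ev a f)"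
  using ipr_cnj[of "szego a" f] by (simp add: ev_eq_ipr)

lemma ev_szego: "cmod a < 1 \<Longrightarrow> cmod b < 1 \<Longrightarrow> ev b (szego a) = szego a b"
  using ev_szego_mult[of a b "\<lambda>z. 1"] by (simp add: H2_const ev_const)

text \<open>Pairing \<open>szego a\<close> with \<open>\<theta> z * h z\<close> gives the conjugate
  of the value of that product at \<open>a\<close>, a multiple of
  \<open>ev a \<theta>\<close>.\<close>

lemma szego_in_K2:
  "\<theta> \<in> Mult \<Longrightarrow> cmod a < 1 \<Longrightarrow> ev a \<theta> = 0 \<Longrightarrow> szego a \<in> K2 \<theta>"
  by (simp add: K2_def H2_szego ipr_szego ev_Mult Mult_H2 H2_imp_L2)

text \<open>On the circle every multiple of \<theta> is a multiple of \<sigma>, through the quotient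
  \<open>cnj (\<sigma> z) * \<theta> z\<close>, and orthogonal complements reverse the
  inclusion.\<close>

lemma K2_subset:
  assumes "unimodular \<sigma>" "(\<lambda>z. cnj (\<sigma> z) * \<theta> z) \<in> Mult"
  shows "K2 \<sigma> \<subseteq> K2 \<theta>"
proof
  fix f assume f: "f \<in> K2 \<sigma>"
  have "ipr f (\<lambda>z. \<theta> z * h z) = 0" if "h \<in> H2" for h
  proof -
    have "ipr f (\<lambda>z. \<theta> z * h z) = ipr f (\<lambda>z. \<sigma> z * ((cnj (\<sigma> z) * \<theta> z) * h z))"
      using unimodularD[OF assms(1)] by (intro ipr_cong) (auto simp: mult.assoc)
    then show ?thesis using f Mult_H2[OF assms(2) that] by (simp add: K2_def)
  qed
  with f show "f \<in> K2 \<theta>" by (simp add: K2_def)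
qed

text \<open>The zeros of the denominator are peeled off one at a time: each must also be a zero of \<open>F\<close>.\<close>

lemma blaschke_quotient_Mult:
  assumes "\<forall>b\<in>set bs. cmod b < 1" "F \<in> Mult" "(\<lambda>z. cnj (blaschke \<gamma> bs z) * F z) \<in> H2"
  shows "(\<lambda>z. cnj (blaschke \<gamma> bs z) * F z) \<in> Mult"
  using assms
proof (induction bs arbitrary: F)
  case Nil
  then show ?case by (simp add: blaschke_Nil Mult_mult Mult_const)
next
  case (Cons c bs)
  define F1 where "F1 z = cnj (blaschke_factor c z) * F z" for z
  have c: "cmod c < 1" and bs: "\<forall>b\<in>set bs. cmod b < 1" using Cons.prems by auto
  have eq: "(\<lambda>z. cnj (blaschke \<gamma> (c # bs) z) * F z) = (\<lambda>z. cnj (blaschke \<gamma> bs z) * F1 z)"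
    by (simp add: blaschke_Cons F1_def mult_ac)
  have u: "(\<lambda>z. cnj (blaschke \<gamma> bs z) * F1 z) \<in> H2" using Cons.prems(3) unfolding eq .
  \<comment> \<open>Multiplying by the remaining factors gives back \<open>F1\<close>, so
    \<open>F1\<close> lies in \<open>H2\<close> and \<open>F\<close> has the zero
    \<open>c\<close>.\<close>
  have "(\<lambda>z. blaschke \<gamma> bs z * (cnj (blaschke \<gamma> bs z) * F1 z)) \<in> H2"
    using Mult_H2[OF Mult_blaschke[OF bs] u] .
  then have F1: "F1 \<in> H2"
    using H2_cong[of "\<lambda>z. blaschke \<gamma> bs z * (cnj (blaschke \<gamma> bs z) * F1 z)" F1]
      unimodularD[OF blaschke_unimodular[OF bs]] by blast
  have "ev c F = ev c (\<lambda>z. blaschke_factor c z * F1 z)"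
    using blaschke_factor_unit[OF c] by (intro ev_cong) (simp add: F1_def mult.assoc[symmetric])
  also have "\<dots> = 0" using c F1 by (simp add: ev_blaschke_factor_mult) (simp add: blaschke_factor_def)
  finally have evF: "ev c F = 0" .
  have "F1 \<in> Mult"
    unfolding Mult_def mem_Collect_eq
  proof (intro conjI ballI)
    show "F1 \<in> Linf"
      unfolding F1_def using Cons.prems(2) c
      by (intro Linf_mult Linf_cnj Linf_blaschke_factor) (auto simp: Mult_def)
    fix f assume f: "f \<in> H2"
    have "(\<lambda>z. cnj (blaschke_factor c z) * (F z * f z)) \<in> H2"
      using c f Cons.prems(2) evF
      by (intro H2_divide_blaschke_factor) (auto simp: Mult_H2 ev_Mult)
    then show "(\<lambda>z. F1 z * f z) \<in> H2" by (simp add: F1_def mult.assoc)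
  qed
  then show ?case unfolding eq using Cons.IH[OF bs _ u] by simp
qed

text \<open>Division by the factor at \<open>a\<close> preserves the vanishing at each later zero
  \<open>c\<close>: distinctness makes \<open>blaschke_factor a c\<close> nonzero.\<close>

lemma H2_divide_blaschke:
  assumes "\<forall>a\<in>set as. cmod a < 1" "distinct as" "g \<in> H2" "\<forall>a\<in>set as. ev a g = 0"
  shows "(\<lambda>z. cnj (blaschke \<gamma> as z) * g z) \<in> H2"
  using assms
proof (induction as arbitrary: g)
  case Nil
  then show ?case by (simp add: blaschke_Nil H2_cmult)
next
  case (Cons a as)
  define g1 where "g1 z = cnj (blaschke_factor a z) * g z" for z
  have a: "cmod a < 1" using Cons.prems by simp
  have g1: "g1 \<in> H2" unfolding g1_def using Cons.prems by (intro H2_divide_blaschke_factor) auto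
  have "ev c g1 = 0" if "c \<in> set as" for c
  proof -
    have c: "cmod c < 1" "c \<noteq> a" "ev c g = 0" using that Cons.prems by auto
    have "ev c g = ev c (\<lambda>z. blaschke_factor a z * g1 z)"
      using blaschke_factor_unit[OF a] by (intro ev_cong) (simp add: g1_def mult.assoc[symmetric])
    also have "\<dots> = blaschke_factor a c * ev c g1" using a c g1 by (simp add: ev_blaschke_factor_mult)
    finally show ?thesis using c szego_denom_nonzero[OF a, of c] by (simp add: blaschke_factor_def)
  qed
  then have "(\<lambda>z. cnj (blaschke \<gamma> as z) * g1 z) \<in> H2" using Cons g1 by auto
  then show ?case by (simp add: g1_def blaschke_Cons mult_ac)
qed

text \<open>Vanishing at all zeros makes \<open>g\<close> a multiple of the Blaschke product, and
  \<open>g\<close> is orthogonal to all such multiples, hence to itself.\<close>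

lemma K2_blaschke_eq_0:
  assumes "\<forall>a\<in>set as. cmod a < 1" "distinct as" "g \<in> K2 (blaschke \<gamma> as)" "\<forall>a\<in>set as. ev a g = 0"
  shows "l2norm g = 0"
proof -
  have "(\<lambda>z. cnj (blaschke \<gamma> as z) * g z) \<in> H2"
    using assms by (intro H2_divide_blaschke) (auto simp: K2_imp_H2)
  then have "ipr g (\<lambda>z. blaschke \<gamma> as z * (cnj (blaschke \<gamma> as z) * g z)) = 0"
    using assms(3) by (simp add: K2_def)
  also have "ipr g (\<lambda>z. blaschke \<gamma> as z * (cnj (blaschke \<gamma> as z) * g z)) = ipr g g"
    using unimodularD[OF blaschke_unimodular[OF assms(1)]] by (intro ipr_cong) auto
  finally show ?thesis using assms(3) by (simp add: ipr_self K2_imp_L2)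
qed

section \<open>Partial fractions and interpolation\<close>

text \<open>The Blaschke product with zero set \<open>S\<close> and phase 0, divided by
  \<open>z - j\<close>. It vanishes on the rest of \<open>S\<close>, so up to scaling these
  functions are dual to the evaluations; on the circle they are the images of the kernels under
  \<open>Cth\<close>.\<close>

definition dual_fun :: "complex set \<Rightarrow> complex \<Rightarrow> complex \<Rightarrow> complex" where
  "dual_fun S j z = (\<Prod>m\<in>S-{j}. z - m) / (\<Prod>m\<in>S. 1 - cnj m * z)"

text \<open>The part independent of \<open>j\<close> of the coefficient
  \<open>pf_coeff S l / (1 - j * cnj l)\<close> of \<open>szego l\<close> in
  \<open>dual_fun S j\<close>.\<close>

definition pf_coeff :: "complex set \<Rightarrow> complex \<Rightarrow> complex" where
  "pf_coeff S l = (\<Prod>m\<in>S. 1 - m * cnj l) / (\<Prod>m\<in>S-{l}. cnj l - cnj m)"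

lemma pf_coeff_nonzero:
  "finite S \<Longrightarrow> \<forall>a\<in>S. cmod a < 1 \<Longrightarrow> l \<in> S \<Longrightarrow> pf_coeff S l \<noteq> 0"
  using szego_denom_nonzero'[of _ l] by (fastforce simp: pf_coeff_def)

text \<open>Both sides are polynomials in \<open>w\<close> of degree below \<open>card S\<close> and
  agree at the \<open>card S\<close> nodes \<open>cnj i\<close> with
  \<open>i \<in> S\<close>.\<close>

lemma lagrange_identity:
  assumes S: "finite S" and j: "j \<in> S"
  shows "(\<Prod>m\<in>S-{j}. 1 - m * w)
       = (\<Sum>l\<in>S. (\<Prod>m\<in>S-{j}. 1 - m * cnj l) / (\<Prod>m\<in>S-{l}. cnj l - cnj m) * (\<Prod>m\<in>S-{l}. w - cnj m))"
proof -
  define c where "c l = (\<Prod>m\<in>S-{j}. 1 - m * cnj l) / (\<Prod>m\<in>S-{l}. cnj l - cnj m)" for l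
  define p where "p = (\<Prod>m\<in>S-{j}. [:1, - m:])"
  define q where "q = (\<Sum>l\<in>S. smult (c l) (\<Prod>m\<in>S-{l}. [:- cnj m, 1:]))"
  have n: "card S > 0" using S j card_gt_0_iff by blast
  have pw: "poly p w = (\<Prod>m\<in>S-{j}. 1 - m * w)" for w
    by (simp add: p_def poly_prod mult.commute)
  have qw: "poly q w = (\<Sum>l\<in>S. c l * (\<Prod>m\<in>S-{l}. w - cnj m))" for w
    by (simp add: q_def poly_prod poly_sum)
  have deg: "degree (\<Prod>m\<in>S-{l}. f m :: complex poly) < card S"
    if "l \<in> S" "\<And>m. degree (f m) \<le> 1" for f l
  proof -
    have "degree (\<Prod>m\<in>S-{l}. f m) \<le> (\<Sum>m\<in>S-{l}. degree (f m))"
      using S degree_prod_sum_le[of "S-{l}" f] by simp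
    also have "\<dots> \<le> (\<Sum>m\<in>S-{l}. 1)" by (intro sum_mono that)
    also have "\<dots> < card S" using S that n by (simp add: card_Diff_singleton)
    finally show ?thesis .
  qed
  have "p = q"
  proof (rule poly_eqI_degree)
    have card: "card (cnj ` S) = card S" by (intro card_image inj_onI) simp
    show "degree p < card (cnj ` S)" unfolding p_def card by (rule deg[OF j]) simp
    show "degree q < card (cnj ` S)" unfolding q_def card
      by (rule degree_sum_less[OF _ n]) (use n in \<open>auto intro!: le_less_trans[OF degree_smult_le] deg\<close>)
    fix w assume "w \<in> cnj ` S"
    then obtain i where i: "i \<in> S" "w = cnj i" by auto
    have "poly q w = (\<Sum>l\<in>S. if l = i then c i * (\<Prod>m\<in>S-{i}. cnj i - cnj m) else 0)"
      unfolding qw i(2) using S i by (intro sum.cong refl) (auto simp: prod_zero_iff)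
    also have "\<dots> = poly p w"
      unfolding pw c_def i(2) using S i by (simp add: prod_zero_iff)
    finally show "poly p w = poly q w" by simp
  qed
  then show ?thesis using pw[of w] qw[of w] by (simp add: c_def)
qed

text \<open>Substituting \<open>w = 1 / z\<close> in Lagrange's formula handles \<open>z \<noteq> 0\<close>; the point \<open>0\<close>
  follows by continuity.\<close>

lemma partial_fraction_poly:
  assumes S: "finite S" and j: "j \<in> S"
  shows "(\<Prod>m\<in>S-{j}. z - m)
       = (\<Sum>l\<in>S. (\<Prod>m\<in>S-{j}. 1 - m * cnj l) / (\<Prod>m\<in>S-{l}. cnj l - cnj m) * (\<Prod>m\<in>S-{l}. 1 - cnj m * z))"
    (is "?P z = ?Q z")
proof -
  have nz: "?P z = ?Q z" if "z \<noteq> 0" for z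
  proof -
    \<comment> \<open>Each product over \<open>S - {l}\<close> has exactly \<open>card S - 1\<close>
      factors, so the power of \<open>z\<close> supplies one \<open>z\<close> to each.\<close>
    have scale: "z ^ (card S - 1) * (\<Prod>m\<in>S-{l}. f m) = (\<Prod>m\<in>S-{l}. z * f m)" if "l \<in> S" for f l
      using S that by (simp add: prod.distrib card_Diff_singleton)
    have "?P z = z ^ (card S - 1) * (\<Prod>m\<in>S-{j}. 1 - m * (1 / z))"
      using \<open>z \<noteq> 0\<close> scale[OF j] by (simp add: right_diff_distrib)
    also have "\<dots> = (\<Sum>l\<in>S. (\<Prod>m\<in>S-{j}. 1 - m * cnj l) / (\<Prod>m\<in>S-{l}. cnj l - cnj m)
        * (z ^ (card S - 1) * (\<Prod>m\<in>S-{l}. 1 / z - cnj m)))"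
      by (subst lagrange_identity[OF S j]) (simp only: sum_distrib_left mult.left_commute)
    also have "\<dots> = ?Q z"
      using \<open>z \<noteq> 0\<close> by (intro sum.cong refl) (simp only: scale right_diff_distrib mult.commute[of z], simp)
    finally show ?thesis .
  qed
  show ?thesis
  proof (cases "z = 0")
    case True
    have P: "(?P \<longlongrightarrow> ?P 0) (at 0)" by (intro tendsto_intros)
    have "(?Q \<longlongrightarrow> ?Q 0) (at 0)" by (intro tendsto_intros)
    moreover have "\<forall>\<^sub>F z in at 0. ?Q z = ?P z"
      using nz by (auto simp: eventually_at_filter intro!: always_eventually)
    ultimately have "(?P \<longlongrightarrow> ?Q 0) (at 0)" by (rule Lim_transform_eventually)
    with P have "?P 0 = ?Q 0" by (rule tendsto_unique[OF at_neq_bot])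
    with True show ?thesis by simp
  qed (rule nz)
qed

lemma dual_fun_partial_fraction:
  assumes S: "finite S" "\<forall>a\<in>S. cmod a < 1" and j: "j \<in> S" and z: "cmod z \<le> 1"
  shows "dual_fun S j z = (\<Sum>l\<in>S. pf_coeff S l / (1 - j * cnj l) * szego l z)"
proof -
  have nz: "1 - cnj m * z \<noteq> 0" if "m \<in> S" for m using S that z szego_denom_nonzero by auto
  have "dual_fun S j z = (\<Sum>l\<in>S. (\<Prod>m\<in>S-{j}. 1 - m * cnj l) / (\<Prod>m\<in>S-{l}. cnj l - cnj m)
     * (\<Prod>m\<in>S-{l}. 1 - cnj m * z) / (\<Prod>m\<in>S. 1 - cnj m * z))"
    unfolding dual_fun_def partial_fraction_poly[OF S(1) j] sum_divide_distrib ..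
  also have "\<dots> = (\<Sum>l\<in>S. pf_coeff S l / (1 - j * cnj l) * szego l z)"
  proof (intro sum.cong refl)
    fix l assume l: "l \<in> S"
    have 1: "(\<Prod>m\<in>S. 1 - cnj m * z) = (1 - cnj l * z) * (\<Prod>m\<in>S-{l}. 1 - cnj m * z)"
      using S l by (simp add: prod.remove)
    \<comment> \<open>\<open>pf_coeff\<close> runs over all of \<open>S\<close>; the division by
      \<open>1 - j * cnj l\<close> removes the extra factor at \<open>m = j\<close>.\<close>
    have 2: "(\<Prod>m\<in>S. 1 - m * cnj l) = (1 - j * cnj l) * (\<Prod>m\<in>S-{j}. 1 - m * cnj l)"
      using S j by (simp add: prod.remove)
    have 3: "(\<Prod>m\<in>S-{l}. 1 - cnj m * z) \<noteq> 0" using S nz by auto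
    have 4: "1 - j * cnj l \<noteq> 0" using S j l szego_denom_nonzero'[of j l] by fastforce
    show "(\<Prod>m\<in>S-{j}. 1 - m * cnj l) / (\<Prod>m\<in>S-{l}. cnj l - cnj m)
     * (\<Prod>m\<in>S-{l}. 1 - cnj m * z) / (\<Prod>m\<in>S. 1 - cnj m * z)
     = pf_coeff S l / (1 - j * cnj l) * szego l z"
      unfolding 1 pf_coeff_def 2 szego_def using 3 4 by simp
  qed
  finally show ?thesis .
qed

section \<open>Interpolation at the zeros\<close>

lemma dual_fun_eq_0: "finite S \<Longrightarrow> i \<in> S \<Longrightarrow> i \<noteq> j \<Longrightarrow> dual_fun S j i = 0"
  by (auto simp: dual_fun_def)

lemma dual_fun_neq_0: "finite S \<Longrightarrow> \<forall>a\<in>S. cmod a < 1 \<Longrightarrow> j \<in> S \<Longrightarrow> dual_fun S j j \<noteq> 0"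
  using szego_denom_nonzero[of _ j] by (fastforce simp: dual_fun_def)

text \<open>The interpolant combines the \<open>dual_fun S j\<close> with weights
  \<open>w j / dual_fun S j j\<close>; their partial fractions give the coefficients of the
  kernels.\<close>

lemma szego_interpolation:
  assumes S: "finite S" "\<forall>a\<in>S. cmod a < 1"
  shows "\<exists>c. \<forall>i\<in>S. (\<Sum>l\<in>S. c l * szego l i) = w i"
proof (intro exI ballI)
  fix i assume i: "i \<in> S"
  have "(\<Sum>l\<in>S. (\<Sum>j\<in>S. w j / dual_fun S j j * (pf_coeff S l / (1 - j * cnj l))) * szego l i)
      = (\<Sum>j\<in>S. w j / dual_fun S j j * (\<Sum>l\<in>S. pf_coeff S l / (1 - j * cnj l) * szego l i))"
    by (simp only: sum_distrib_left sum_distrib_right mult.assoc) (rule sum.swap)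
  also have "\<dots> = (\<Sum>j\<in>S. w j / dual_fun S j j * dual_fun S j i)"
    using S i by (intro sum.cong refl) (simp add: dual_fun_partial_fraction less_imp_le)
  also have "\<dots> = (\<Sum>j\<in>S. if j = i then w i else 0)"
    using S i by (intro sum.cong refl) (auto simp: dual_fun_eq_0 dual_fun_neq_0)
  also have "\<dots> = w i" using S i by simp
  finally show "(\<Sum>l\<in>S. (\<Sum>j\<in>S. w j / dual_fun S j j * (pf_coeff S l / (1 - j * cnj l))) * szego l i) = w i" .
qed

text \<open>Interpolation solves the transposed system for every right-hand side; pairing its
  solution for the unit vector at \<open>j\<close> with the relations for \<open>x\<close> isolates
  \<open>x j\<close>.\<close>

lemma szego_matrix_nonsingular:
  assumes S: "finite S" "\<forall>a\<in>S. cmod a < 1" and x: "\<forall>i\<in>S. (\<Sum>l\<in>S. x l * szego i l) = 0" and j: "j \<in> S"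
  shows "x j = 0"
proof -
  obtain c where c: "\<forall>l\<in>S. (\<Sum>i\<in>S. c i * szego i l) = (if l = j then 1 else 0)"
    using szego_interpolation[OF S, of "\<lambda>l. if l = j then 1 else 0"] by blast
  have "x j = (\<Sum>l\<in>S. if l = j then x j else 0)" using S j by simp
  also have "\<dots> = (\<Sum>l\<in>S. x l * (\<Sum>i\<in>S. c i * szego i l))"
    using c by (intro sum.cong refl) auto
  also have "\<dots> = (\<Sum>i\<in>S. c i * (\<Sum>l\<in>S. x l * szego i l))"
    by (simp only: sum_distrib_left mult.left_commute) (rule sum.swap)
  finally show ?thesis using x by simp
qed

lemma Linf_span: "\<forall>a\<in>S. cmod a < 1 \<Longrightarrow> (\<lambda>z. \<Sum>l\<in>S. c l * szego l z) \<in> Linf"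
  unfolding szego_def
  by (rule Linf_continuous) (use szego_denom_nonzero in \<open>fastforce intro!: continuous_intros\<close>)

lemma szego_in_K2_blaschke:
  "\<forall>a\<in>set as. cmod a < 1 \<Longrightarrow> a \<in> set as \<Longrightarrow> szego a \<in> K2 (blaschke \<gamma> as)"
  by (simp add: szego_in_K2 Mult_blaschke ev_blaschke blaschke_zero)

lemma ev_span:
  assumes "\<forall>a\<in>S. cmod a < 1" "cmod i < 1"
  shows "ev i (\<lambda>z. \<Sum>l\<in>S. c l * szego l z) = (\<Sum>l\<in>S. c l * szego l i)"
  using assms by (simp add: ev_eq_ipr Linf_span Linf_imp_L2 ipr_sum_left L2_szego) (simp add: ev_eq_ipr[symmetric] L2_szego ev_szego)

lemma K2_blaschke_interpolation:
  assumes as: "\<forall>a\<in>set as. cmod a < 1"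
  obtains c where "(\<lambda>z. \<Sum>l\<in>set as. c l * szego l z) \<in> K2 (blaschke \<gamma> as)"
    and "\<And>i. i \<in> set as \<Longrightarrow> ev i (\<lambda>z. \<Sum>l\<in>set as. c l * szego l z) = w i"
proof -
  obtain c where c: "\<forall>i\<in>set as. (\<Sum>l\<in>set as. c l * szego l i) = w i"
    using szego_interpolation[of "set as" w] as by auto
  have "(\<lambda>z. \<Sum>l\<in>set as. c l * szego l z) \<in> K2 (blaschke \<gamma> as)"
    using as by (intro K2_sum Mult_blaschke szego_in_K2_blaschke) auto
  then show ?thesis using that c as by (simp add: ev_span)
qed

text \<open>The difference of \<open>f\<close> and the interpolant of its values at the zeros is in
  the model space and vanishes at every zero, hence is null.\<close>

lemma K2_blaschke_span:
  assumes as: "\<forall>a\<in>set as. cmod a < 1" "distinct as" and f: "f \<in> K2 (blaschke \<gamma> as)"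
  obtains c where "l2eq f (\<lambda>z. \<Sum>l\<in>set as. c l * szego l z)"
proof -
  obtain c where g: "(\<lambda>z. \<Sum>l\<in>set as. c l * szego l z) \<in> K2 (blaschke \<gamma> as)" (is "?g \<in> _")
    and c: "\<And>i. i \<in> set as \<Longrightarrow> ev i (\<lambda>z. \<Sum>l\<in>set as. c l * szego l z) = ev i f"
    using K2_blaschke_interpolation[OF as(1), of \<gamma> "\<lambda>i. ev i f"] by blast
  have "l2norm (\<lambda>z. f z - ?g z) = 0"
  proof (rule K2_blaschke_eq_0[OF as])
    show "(\<lambda>z. f z - ?g z) \<in> K2 (blaschke \<gamma> as)" using as f g by (intro K2_diff Mult_blaschke)
    show "\<forall>a\<in>set as. ev a (\<lambda>z. f z - ?g z) = 0"
      using as c f g by (simp add: ev_diff K2_imp_L2)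
  qed
  then show ?thesis using that[of c] by (simp add: l2eq_def)
qed

section \<open>Projections, conjugations and C-symmetry\<close>

text \<open>\<open>proj_onto\<close> is a Hilbert choice, so its properties are available only where
  such a \<open>g\<close> exists; existence is tracked separately.\<close>

definition has_proj :: "(complex \<Rightarrow> complex) set \<Rightarrow> (complex \<Rightarrow> complex) \<Rightarrow> bool" where
  "has_proj K f \<longleftrightarrow> (\<exists>g\<in>K. \<forall>h\<in>K. ipr (\<lambda>z. f z - g z) h = 0)"

lemma proj_onto_props:
  assumes "has_proj K f"
  shows "proj_onto K f \<in> K" "h \<in> K \<Longrightarrow> ipr (\<lambda>z. f z - proj_onto K f z) h = 0"
proof -
  have "\<exists>g. g \<in> K \<and> (\<forall>h\<in>K. ipr (\<lambda>z. f z - g z) h = 0)"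
    using assms by (auto simp: has_proj_def)
  from someI_ex[OF this]
  show "proj_onto K f \<in> K" "h \<in> K \<Longrightarrow> ipr (\<lambda>z. f z - proj_onto K f z) h = 0"
    unfolding proj_onto_def by auto
qed

lemma ipr_proj_onto:
  assumes "has_proj (K2 \<theta>) f" "f \<in> L2" "h \<in> K2 \<theta>"
  shows "ipr (proj_onto (K2 \<theta>) f) h = ipr f h"
  using proj_onto_props[OF assms(1)] assms by (auto simp: ipr_diff_left K2_imp_L2)

lemma ipr_l2eq_right:
  assumes "l2eq f g" "f \<in> L2" "g \<in> L2" "h \<in> L2" shows "ipr h f = ipr h g"
  using ipr_l2eq[OF assms] by (metis ipr_cnj)

text \<open>The interpolant of the values of \<open>f\<close> at the zeros is the projection: the
  difference is orthogonal to each kernel, and the kernels span.\<close>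

lemma has_proj_blaschke:
  assumes as: "\<forall>a\<in>set as. cmod a < 1" "distinct as" and f: "f \<in> L2"
  shows "has_proj (K2 (blaschke \<gamma> as)) f"
proof -
  obtain c where "(\<lambda>z. \<Sum>l\<in>set as. c l * szego l z) \<in> K2 (blaschke \<gamma> as)"
    and "\<And>i. i \<in> set as \<Longrightarrow> ev i (\<lambda>z. \<Sum>l\<in>set as. c l * szego l z) = ev i f"
    using K2_blaschke_interpolation[OF as(1), of \<gamma> "\<lambda>i. ev i f"] by blast
  then obtain g where g: "g \<in> K2 (blaschke \<gamma> as)" and evg: "\<And>i. i \<in> set as \<Longrightarrow> ev i g = ev i f"
    by blast
  have L: "(\<lambda>z. f z - g z) \<in> L2" using f g by (simp add: L2_diff K2_imp_L2)
  have ev0: "ev i (\<lambda>z. f z - g z) = 0" if "i \<in> set as" for i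
    using that as evg f g by (simp add: ev_diff K2_imp_L2)
  have "ipr (\<lambda>z. f z - g z) h = 0" if h: "h \<in> K2 (blaschke \<gamma> as)" for h
  proof -
    obtain d where d: "l2eq h (\<lambda>z. \<Sum>l\<in>set as. d l * szego l z)"
      using K2_blaschke_span[OF as h] .
    have "ipr (\<lambda>z. f z - g z) h = ipr (\<lambda>z. f z - g z) (\<lambda>z. \<Sum>l\<in>set as. d l * szego l z)"
      using d K2_imp_L2[OF h] Linf_imp_L2[OF Linf_span[OF as(1)]] L by (rule ipr_l2eq_right)
    also have "\<dots> = (\<Sum>l\<in>set as. cnj (d l) * ipr (\<lambda>z. f z - g z) (szego l))"
      using L as by (intro ipr_sum_right) (auto simp: L2_szego)
    also have "\<dots> = 0" using L as ev0 by (intro sum.neutral) (simp add: ev_eq_ipr)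
    finally show ?thesis .
  qed
  with g show ?thesis by (auto simp: has_proj_def)
qed

text \<open>The reproducing kernel of the model space, with \<open>ev a \<theta>\<close> as the
  value of \<theta> at \<open>a\<close>. It is the projection of \<open>szego a\<close>.\<close>

definition model_kernel :: "(complex \<Rightarrow> complex) \<Rightarrow> complex \<Rightarrow> complex \<Rightarrow> complex" where
  "model_kernel \<theta> a z = szego a z - cnj (ev a \<theta>) * (\<theta> z * szego a z)"

lemma model_kernel_in_K2:
  assumes "\<theta> \<in> Mult" "unimodular \<theta>" "cmod a < 1"
  shows "model_kernel \<theta> a \<in> K2 \<theta>"
proof -
  have H: "(\<lambda>z. \<theta> z * szego a z) \<in> H2" using assms by (simp add: Mult_H2 H2_szego)
  have "ipr (model_kernel \<theta> a) (\<lambda>z. \<theta> z * h z) = 0" if h: "h \<in> H2" for h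
  proof -
    have "ipr (\<lambda>z. \<theta> z * szego a z) (\<lambda>z. \<theta> z * h z) = mean (\<lambda>z. \<theta> z * szego a z * cnj (\<theta> z * h z))"
      using H Mult_H2[OF assms(1) h] by (simp add: ipr_eq_mean H2_imp_L2)
    also have "\<dots> = mean (\<lambda>z. szego a z * cnj (h z))"
    proof (rule mean_cong)
      fix z :: complex assume "cmod z = 1"
      then show "\<theta> z * szego a z * cnj (\<theta> z * h z) = szego a z * cnj (h z)"
        using unimodularD[OF assms(2), of z "szego a z * cnj (h z)"] by (simp add: mult_ac)
    qed
    also have "\<dots> = ipr (szego a) h" using assms h by (simp add: ipr_eq_mean H2_imp_L2 L2_szego)
    finally show ?thesis
      unfolding model_kernel_def
      using assms h H
      by (simp add: ipr_diff_left L2_szego L2_cmult H2_imp_L2 Mult_H2 ipr_cmult_left ipr_szego ev_Mult)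
  qed
  moreover have "model_kernel \<theta> a \<in> H2"
    unfolding model_kernel_def[abs_def] using assms H by (intro H2_diff H2_cmult H2_szego)
  ultimately show ?thesis by (simp add: K2_def)
qed

lemma ipr_model_kernel:
  assumes "\<theta> \<in> Mult" "cmod a < 1" "h \<in> K2 \<theta>"
  shows "ipr (model_kernel \<theta> a) h = ipr (szego a) h"
proof -
  have "ipr h (\<lambda>z. \<theta> z * szego a z) = 0" using assms by (simp add: K2_def H2_szego)
  then have "ipr (\<lambda>z. \<theta> z * szego a z) h = 0" by (metis ipr_cnj complex_cnj_zero)
  then show ?thesis
    unfolding model_kernel_def
    using assms by (simp add: ipr_diff_left L2_szego L2_cmult H2_imp_L2 H2_szego Mult_H2 K2_imp_L2 ipr_cmult_left)
qed

text \<open>Serves divisors whose zeros may repeat, where the kernels at the zeros need not span.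
  The projection replaces each \<open>szego a\<close> by
  \<open>model_kernel \<theta> a\<close>.\<close>

lemma has_proj_span:
  assumes \<theta>: "\<theta> \<in> Mult" "unimodular \<theta>" and S: "\<forall>a\<in>S. cmod a < 1" and f: "f \<in> L2"
    and c: "l2eq f (\<lambda>z. \<Sum>a\<in>S. c a * szego a z)"
  shows "has_proj (K2 \<theta>) f"
  unfolding has_proj_def
proof (intro bexI ballI)
  let ?g = "\<lambda>z. \<Sum>a\<in>S. c a * model_kernel \<theta> a z"
  show g: "?g \<in> K2 \<theta>" using \<theta> S by (intro K2_sum model_kernel_in_K2) auto
  fix h assume h: "h \<in> K2 \<theta>"
  have "ipr f h = ipr (\<lambda>z. \<Sum>a\<in>S. c a * szego a z) h"
    using c f Linf_imp_L2[OF Linf_span[OF S]] K2_imp_L2[OF h] by (rule ipr_l2eq)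
  also have "\<dots> = (\<Sum>a\<in>S. c a * ipr (szego a) h)"
    using S h by (intro ipr_sum_left) (auto simp: L2_szego K2_imp_L2)
  also have "\<dots> = (\<Sum>a\<in>S. c a * ipr (model_kernel \<theta> a) h)"
    using \<theta> S h by (intro sum.cong refl) (simp add: ipr_model_kernel)
  also have "\<dots> = ipr ?g h"
    using \<theta> S h by (intro ipr_sum_left[symmetric]) (auto simp: K2_imp_L2 intro: K2_imp_L2[OF model_kernel_in_K2])
  finally show "ipr (\<lambda>z. f z - ?g z) h = 0"
    using f g h by (simp add: ipr_diff_left K2_imp_L2)
qed

text \<open>Conjugation exchanges the two conditions defining the model space: orthogonality of
  \<open>f\<close> to multiples of \<theta> makes \<open>Cth \<theta> f\<close> analytic, and
  analyticity of \<open>f\<close> makes it orthogonal to them. The kernel expansion reduces the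
  second half to \<open>H2_szego_mult\<close>.\<close>

lemma Cth_in_K2:
  assumes \<theta>: "\<theta> \<in> Mult" "unimodular \<theta>" and S: "\<forall>a\<in>S. cmod a < 1" and f: "f \<in> K2 \<theta>"
    and c: "l2eq f (\<lambda>z. \<Sum>a\<in>S. c a * szego a z)"
  shows "Cth \<theta> f \<in> K2 \<theta>"
proof -
  have L: "Cth \<theta> f \<in> L2"
    unfolding Cth_def using \<theta> f
    by (intro L2_bounded_mult L2_cnj L2_bounded_mult[OF Linf_id]) (auto simp: Mult_def K2_imp_L2)
  have "mean (\<lambda>z. z ^ Suc m * Cth \<theta> f z) = 0" for m
  proof -
    have "mean (\<lambda>z. z ^ Suc m * Cth \<theta> f z) = mean (\<lambda>z. cnj (f z * cnj (\<theta> z * z ^ m)))"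
    proof (rule mean_cong)
      fix z :: complex assume "cmod z = 1"
      then have "z ^ Suc m * Cth \<theta> f z = (z * cnj z) * (z ^ m * \<theta> z * cnj (f z))"
        by (simp add: Cth_def mult_ac)
      then show "z ^ Suc m * Cth \<theta> f z = cnj (f z * cnj (\<theta> z * z ^ m))"
        using unit_mult_cnj[OF \<open>cmod z = 1\<close>] by (simp add: mult_ac)
    qed
    also have "\<dots> = cnj (ipr f (\<lambda>z. \<theta> z * z ^ m))"
      unfolding mean_cnj
      using \<theta> f by (subst ipr_eq_mean) (auto simp: K2_imp_L2 L2_bounded_mult Linf_imp_L2 Linf_power Mult_imp_Linf)
    also have "\<dots> = 0"
      using f H2_power_mult[OF H2_const[of 1], of m] by (simp add: K2_def)
    finally show ?thesis .
  qed
  with L have H: "Cth \<theta> f \<in> H2" by (simp add: H2_iff)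
  have "ipr (Cth \<theta> f) (\<lambda>z. \<theta> z * h z) = 0" if h: "h \<in> H2" for h
  proof -
    have zh: "(\<lambda>z. cnj (z * h z)) \<in> L2" using h by (intro L2_cnj H2_imp_L2 H2_id_mult)
    have "ipr (Cth \<theta> f) (\<lambda>z. \<theta> z * h z) = mean (\<lambda>z. Cth \<theta> f z * cnj (\<theta> z * h z))"
      using L Mult_H2[OF \<theta>(1) h] by (simp add: ipr_eq_mean H2_imp_L2)
    also have "\<dots> = mean (\<lambda>z. cnj (f z * cnj (cnj (z * h z))))"
    proof (rule mean_cong)
      fix z :: complex assume "cmod z = 1"
      then show "Cth \<theta> f z * cnj (\<theta> z * h z) = cnj (f z * cnj (cnj (z * h z)))"
        using unimodularD[OF \<theta>(2), of z "cnj z * cnj (f z) * cnj (h z)"] by (simp add: Cth_def mult_ac)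
    qed
    also have "\<dots> = cnj (ipr f (\<lambda>z. cnj (z * h z)))"
      using f zh by (simp only: mean_cnj ipr_eq_mean K2_imp_L2)
    also have "ipr f (\<lambda>z. cnj (z * h z)) = ipr (\<lambda>z. \<Sum>a\<in>S. c a * szego a z) (\<lambda>z. cnj (z * h z))"
      using c K2_imp_L2[OF f] Linf_imp_L2[OF Linf_span[OF S]] zh by (rule ipr_l2eq)
    also have "\<dots> = (\<Sum>a\<in>S. c a * ipr (szego a) (\<lambda>z. cnj (z * h z)))"
      using S zh by (intro ipr_sum_left) (auto simp: L2_szego)
    also have "\<dots> = 0"
    proof (intro sum.neutral ballI)
      fix a assume "a \<in> S"
      then have "cmod a < 1" using S by simp
      then have "ipr (szego a) (\<lambda>z. cnj (z * h z)) = mean (\<lambda>z. z ^ Suc 0 * (szego a z * h z))"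
        using zh by (simp add: ipr_eq_mean L2_szego mult_ac)
      also have "\<dots> = 0" using H2_szego_mult[OF \<open>cmod a < 1\<close> h] unfolding H2_iff by blast
      finally show "c a * ipr (szego a) (\<lambda>z. cnj (z * h z)) = 0" by simp
    qed
    finally show ?thesis by simp
  qed
  with H show ?thesis by (simp add: K2_def)
qed

text \<open>The projection drops out when paired with elements of the model space, and the outer
  conjugation moves to the other slot.\<close>

lemma C_symmetric_iff:
  assumes C: "\<And>f. f \<in> K2 \<theta> \<Longrightarrow> Cth \<theta> f \<in> K2 \<theta>"
    and T: "\<And>f. f \<in> K2 \<theta> \<Longrightarrow> T f \<in> L2 \<and> has_proj (K2 \<theta>) (T f)"
  shows "C_symmetric \<theta> (\<lambda>f. proj_onto (K2 \<theta>) (T f)) \<longleftrightarrow>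
    (\<forall>f\<in>K2 \<theta>. \<forall>g\<in>K2 \<theta>. ipr (T (Cth \<theta> f)) (Cth \<theta> g) = ipr (T g) f)"
proof -
  \<comment> \<open>Both sides integrate \<open>\<theta> z\<close> times the conjugates of
    \<open>z\<close>, \<open>w z\<close> and \<open>g z\<close>, which is symmetric in
    \<open>w\<close> and \<open>g\<close>.\<close>
  have swap: "ipr (Cth \<theta> w) g = ipr (Cth \<theta> g) w" for w g
    by (simp add: ipr_def Cth_def mult_ac)
  have P: "ipr g (proj_onto (K2 \<theta>) (T f)) = cnj (ipr (T f) g)" if "f \<in> K2 \<theta>" "g \<in> K2 \<theta>" for f g
    using ipr_proj_onto[of \<theta> "T f" g] T that ipr_cnj[of g "proj_onto (K2 \<theta>) (T f)"] by simp
  show ?thesis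
    unfolding C_symmetric_def is_adjoint_on_def swap[of "proj_onto (K2 \<theta>) (T f)" for f]
    using C by (simp add: P)
qed

section \<open>The matrix of an operator with symmetric compressions\<close>

text \<open>With \<open>M i l = \<langle>A k\<^sub>i, k\<^sub>l\<rangle> (1 - cnj i * l)\<close>, this is the symmetry of the compression of \<open>A\<close>
  to the span of the \<open>k\<^sub>l\<close>, \<open>l \<in> S\<close>, tested on \<open>C k\<^sub>i\<close> and \<open>k\<^sub>j\<close>.\<close>

definition symmetry_relation :: "complex set \<Rightarrow> (complex \<Rightarrow> complex \<Rightarrow> complex) \<Rightarrow> bool" where
  "symmetry_relation S M \<longleftrightarrow> (\<forall>i\<in>S. \<forall>j\<in>S.
     (\<Sum>l\<in>S. cnj (pf_coeff S l) * szego j l * szego i l * M i l) =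
     (\<Sum>l\<in>S. cnj (pf_coeff S l) * szego i l * szego j l * M j l))"

lemma cnj_szego: "cnj (szego a b) = szego b a"
  by (simp add: szego_def mult.commute)

lemma szego_nonzero: "cmod a < 1 \<Longrightarrow> cmod z \<le> 1 \<Longrightarrow> szego a z \<noteq> 0"
  using szego_denom_nonzero[of a z] by (simp add: szego_def)

text \<open>Up to conjugation the sum is the partial fraction expansion of
  \<open>dual_fun S j\<close> at its zero \<open>i\<close>.\<close>

lemma pf_coeff_orthogonality:
  assumes S: "finite S" "\<forall>a\<in>S. cmod a < 1" and ij: "i \<in> S" "j \<in> S" "i \<noteq> j"
  shows "(\<Sum>l\<in>S. cnj (pf_coeff S l) * szego j l * szego i l) = 0"
proof -
  have "(\<Sum>l\<in>S. cnj (pf_coeff S l) * szego j l * szego i l)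
      = cnj (\<Sum>l\<in>S. pf_coeff S l / (1 - j * cnj l) * szego l i)"
    unfolding cnj_sum by (intro sum.cong refl) (simp add: szego_def mult.commute)
  also have "\<dots> = cnj (dual_fun S j i)"
    using S ij by (subst dual_fun_partial_fraction) (auto simp: less_imp_le)
  finally show ?thesis using S ij by (simp add: dual_fun_eq_0)
qed

text \<open>Rows \<open>i\<close> and \<open>j\<close> carry the same weights. The term
  \<open>v l\<close> cancels in their difference, and the constant \<open>u i - u j\<close> meets
  weights of sum 0.\<close>

lemma symmetry_relation_diff:
  assumes S: "finite S" "\<forall>a\<in>S. cmod a < 1" and sym: "symmetry_relation S M"
    and ij: "i \<in> S" "j \<in> S" "i \<noteq> j"
  shows "(\<Sum>l\<in>S. cnj (pf_coeff S l) * szego j l * szego i l * ((M i l - u i - v l) - (M j l - u j - v l))) = 0"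
proof -
  define w where "w l = cnj (pf_coeff S l) * szego j l * szego i l" for l
  have w: "(\<Sum>l\<in>S. w l) = 0" using pf_coeff_orthogonality[OF S ij] by (simp add: w_def)
  have "(\<Sum>l\<in>S. w l * M i l) = (\<Sum>l\<in>S. cnj (pf_coeff S l) * szego i l * szego j l * M j l)"
    using sym ij unfolding symmetry_relation_def w_def by blast
  also have "\<dots> = (\<Sum>l\<in>S. w l * M j l)" by (simp add: w_def mult_ac)
  finally have "(\<Sum>l\<in>S. w l * M i l) - (\<Sum>l\<in>S. w l * M j l) - (u i - u j) * (\<Sum>l\<in>S. w l) = 0"
    using w by simp
  also have "(\<Sum>l\<in>S. w l * M i l) - (\<Sum>l\<in>S. w l * M j l) - (u i - u j) * (\<Sum>l\<in>S. w l)
     = (\<Sum>l\<in>S. w l * ((M i l - u i - v l) - (M j l - u j - v l)))"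
    unfolding sum_distrib_left sum_subtractf[symmetric] by (intro sum.cong refl) (simp add: algebra_simps)
  finally show ?thesis by (simp add: w_def)
qed

lemma additive_structure:
  assumes "\<forall>a\<in>set as. cmod a < 1" "distinct as"
    and "\<forall>n\<in>{1..length as}. symmetry_relation (set (take n as)) M"
  shows "\<exists>u v. \<forall>i\<in>set as. \<forall>l\<in>set as. M i l = u i + (v l :: complex)"
  using assms
proof (induction as rule: rev_induct)
  case Nil
  then show ?case by simp
next
  case (snoc x xs)
  have "\<forall>n\<in>{1..length xs}. symmetry_relation (set (take n xs)) M"
  proof
    fix n assume "n \<in> {1..length xs}"
    then show "symmetry_relation (set (take n xs)) M" using snoc.prems(3)[rule_format, of n] by simp
  qed
  then obtain u v where uv: "\<forall>i\<in>set xs. \<forall>l\<in>set xs. M i l = u i + v l"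
    using snoc by auto
  show ?case
  proof (cases "xs = []")
    case True
    then show ?thesis by (intro exI[of _ "\<lambda>i. M i x"] exI[of _ "\<lambda>l. 0"]) simp
  next
    case False
    define T where "T = set (xs @ [x])"
    have T: "finite T" "\<forall>a\<in>T. cmod a < 1" and x: "x \<in> T" "x \<notin> set xs" and sub: "\<And>i. i \<in> set xs \<Longrightarrow> i \<in> T"
      and Tx: "T - {x} = set xs"
      using snoc.prems by (auto simp: T_def)
    have sym: "symmetry_relation T M"
      using snoc.prems(3)[rule_format, of "length (xs @ [x])"] by (simp add: T_def)
    obtain i0 where i0: "i0 \<in> set xs" using False by (meson list.set_sel(1))
    \<comment> \<open>The new column is normalised at one old row \<open>i0\<close> and the new row
      at the diagonal, so \<open>D i0 x\<close> and \<open>D x x\<close> vanish by choice.\<close>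
    define v' where "v' = v(x := M i0 x - u i0)"
    define u' where "u' = u(x := M x x - v' x)"
    define D where "D i l = M i l - u' i - v' l" for i l
    have D0: "D i l = 0" if "i \<in> set xs" "l \<in> set xs" for i l
      using that uv x by (auto simp: D_def u'_def v'_def)
    have Di0: "D i0 x = 0" "D x x = 0"
      using i0 x by (auto simp: D_def u'_def v'_def)
    \<comment> \<open>The term of the new zero \<open>x\<close> is split off from the old
      columns.\<close>
    have rel: "cnj (pf_coeff T x) * szego j x * szego i x * (D i x - D j x)
        + (\<Sum>l\<in>set xs. cnj (pf_coeff T l) * szego j l * szego i l * (D i l - D j l)) = 0"
      if "i \<in> T" "j \<in> T" "i \<noteq> j" for i j
      using symmetry_relation_diff[OF T sym that, of u' v'] T x Tx
      unfolding D_def by (subst (asm) sum.remove[of _ x]) auto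
    \<comment> \<open>For two old rows the old columns contribute nothing, so the new column's term
      alone is 0, and its weight is nonzero.\<close>
    have Dx: "D j x = 0" if j: "j \<in> set xs" for j
    proof (cases "j = i0")
      case False
      have "cnj (pf_coeff T x) * szego j x * szego i0 x * (D i0 x - D j x) = 0"
        using rel[of i0 j] sub i0 j False by (simp add: D0)
      moreover have "pf_coeff T x \<noteq> 0" "szego j x \<noteq> 0" "szego i0 x \<noteq> 0"
        using T x i0 j sub by (auto simp: pf_coeff_nonzero szego_nonzero less_imp_le)
      ultimately show ?thesis using Di0 by simp
    qed (use Di0 in simp)
    \<comment> \<open>Pairing an old row with the new one leaves only the entries
      \<open>D x l\<close>; letting \<open>i\<close> run over the old zeros gives a homogeneous
      Cauchy system for them.\<close>
    have Dl: "D x l = 0" if l: "l \<in> set xs" for l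
    proof -
      have "\<forall>i\<in>set xs. (\<Sum>l\<in>set xs. (cnj (pf_coeff T l) * szego x l * D x l) * szego i l) = 0"
      proof
        fix i assume i: "i \<in> set xs"
        then have "(\<Sum>l\<in>set xs. cnj (pf_coeff T l) * szego x l * szego i l * (D i l - D x l)) = 0"
          using rel[of i x] sub x by (auto simp: Dx Di0)
        then have "(\<Sum>l\<in>set xs. - ((cnj (pf_coeff T l) * szego x l * D x l) * szego i l)) = 0"
          using i by (simp add: D0 mult_ac)
        then show "(\<Sum>l\<in>set xs. (cnj (pf_coeff T l) * szego x l * D x l) * szego i l) = 0"
          by (simp add: sum_negf)
      qed
      then have "cnj (pf_coeff T l) * szego x l * D x l = 0"
        using T sub l by (intro szego_matrix_nonsingular[of "set xs" "\<lambda>l. cnj (pf_coeff T l) * szego x l * D x l"]) auto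
      moreover have "pf_coeff T l \<noteq> 0" "szego x l \<noteq> 0"
        using T x l sub by (auto simp: pf_coeff_nonzero szego_nonzero less_imp_le)
      ultimately show ?thesis by simp
    qed
    have "\<forall>i\<in>T. \<forall>l\<in>T. M i l = u' i + v' l"
    proof (intro ballI)
      fix i l assume "i \<in> T" "l \<in> T"
      then have "D i l = 0" using D0 Dx Dl Di0 unfolding T_def by auto
      then show "M i l = u' i + v' l" by (simp add: D_def algebra_simps)
    qed
    then show ?thesis unfolding T_def by blast
  qed
qed

section \<open>Truncated Toeplitz operators\<close>

lemma blaschke_take_drop:
  "blaschke \<gamma> as z = blaschke 0 (take n as) z * blaschke \<gamma> (drop n as) z"
proof -
  have "blaschke \<gamma> (xs @ ys) z = blaschke 0 xs z * blaschke \<gamma> ys z" for xs ys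
    by (simp add: blaschke_def mult_ac)
  from this[of "take n as" "drop n as"] show ?thesis by simp
qed

lemma blaschke_take_divides:
  assumes "\<forall>a\<in>set as. cmod a < 1"
  shows "divides_inner (blaschke 0 (take n as)) (blaschke \<gamma> as)"
proof -
  have as: "\<forall>a\<in>set (take n as). cmod a < 1" "\<forall>a\<in>set (drop n as). cmod a < 1"
    using assms set_take_subset[of n as] set_drop_subset[of n as] by auto
  \<comment> \<open>On the circle the conjugate of the prefix is its inverse; the whole phase
    \<gamma> stays with the quotient.\<close>
  have eq: "cnj (blaschke 0 (take n as) z) * blaschke \<gamma> as z = blaschke \<gamma> (drop n as) z" if "cmod z = 1" for z
    using unimodularD[OF blaschke_unimodular[OF as(1)] that, of 0 "blaschke \<gamma> (drop n as) z"]
    by (subst blaschke_take_drop[of _ _ _ n]) (simp add: mult_ac)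
  have "cmod (blaschke \<gamma> (drop n as) z) = 1" if "cmod z = 1" for z
  proof -
    have "blaschke \<gamma> (drop n as) z * cnj (blaschke \<gamma> (drop n as) z) = 1"
      using blaschke_unimodular[OF as(2)] that by (simp add: unimodular_def)
    then have "cmod (blaschke \<gamma> (drop n as) z) * cmod (blaschke \<gamma> (drop n as) z) = 1"
      by (metis complex_mod_cnj norm_mult norm_one)
    then show ?thesis using square_eq_1_iff[of "cmod (blaschke \<gamma> (drop n as) z)"] norm_ge_zero
      by (smt (verit))
  qed
  then show ?thesis
    unfolding divides_inner_def is_inner_def
    using eq H2_cong[of "\<lambda>z. cnj (blaschke 0 (take n as) z) * blaschke \<gamma> as z" "blaschke \<gamma> (drop n as)"]
      Mult_imp_H2[OF Mult_blaschke[OF as(2)]]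
    by simp
qed

lemma K2_subset_divides:
  assumes "\<forall>a\<in>set as. cmod a < 1" "\<forall>b\<in>set bs. cmod b < 1"
    and "divides_inner (blaschke \<delta> bs) (blaschke \<gamma> as)"
  shows "K2 (blaschke \<delta> bs) \<subseteq> K2 (blaschke \<gamma> as)"
  using assms
  by (intro K2_subset blaschke_unimodular blaschke_quotient_Mult Mult_blaschke)
     (auto simp: divides_inner_def is_inner_def)

text \<open>The product vanishes at its listed zeros, while the infinite disc contains a point
  outside this finite list, where every factor is nonzero.\<close>

lemma blaschke_nonconstant:
  assumes "\<forall>a\<in>set as. cmod a < 1" "as \<noteq> []"
  shows "nonconstant_on_disc (blaschke \<gamma> as)"
proof -
  have "infinite (ball (0::complex) 1)" using uncountable_ball[of 1 "0::complex"] countable_finite by auto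
  then have "\<not> ball (0::complex) 1 \<subseteq> set as" using finite_subset by blast
  then obtain z where z: "cmod z < 1" "z \<notin> set as" by (auto simp: subset_iff)
  have "blaschke \<gamma> as z \<noteq> 0"
    using assms z szego_denom_nonzero[of _ z] by (force simp: blaschke_def prod_list_zero_iff)
  moreover obtain a where "a \<in> set as" using assms(2) by (meson list.set_sel(1))
  ultimately show ?thesis
    using z assms blaschke_zero[of a as \<gamma>] unfolding nonconstant_on_disc_def by metis
qed

text \<open>On the circle \<open>cnj (szego j z)\<close> is \<open>z / (z - j)\<close>, which
  cancels the zero of the product at \<open>j\<close>. This opens conjugated kernels to partial
  fractions.\<close>

lemma Cth_szego:
  assumes bs: "\<forall>a\<in>set bs. cmod a < 1" "distinct bs" and j: "j \<in> set bs" and z: "cmod z = 1"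
  shows "Cth (blaschke 0 bs) (szego j) z = dual_fun (set bs) j z"
proof -
  have "blaschke 0 bs z = (\<Prod>a\<in>set bs. (z - a) / (1 - cnj a * z))"
    using bs by (simp add: blaschke_def prod.distinct_set_conv_list)
  also have "\<dots> = (z - j) * dual_fun (set bs) j z"
    using j by (simp add: dual_fun_def prod_dividef prod.remove[of _ j "\<lambda>a. z - a"])
  finally have "Cth (blaschke 0 bs) (szego j) z
      = ((z - j) * cnj (szego j z)) * cnj z * dual_fun (set bs) j z"
    by (simp add: Cth_def mult_ac)
  also have "(z - j) * cnj (szego j z) = z" using bs j z by (simp add: szego_boundary)
  finally show ?thesis using unit_mult_cnj[OF z] by simp
qed

lemma Cth_Cth: "unimodular \<theta> \<Longrightarrow> cmod z = 1 \<Longrightarrow> Cth \<theta> (Cth \<theta> f) z = f z"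
  using unit_mult_cnj[of z] unimodularD[of \<theta> z "(cnj z * z) * f z"]
  by (simp add: Cth_def mult.assoc mult.left_commute[of "cnj z"])

lemma L2_cong_AE:
  assumes "f \<in> L2" "g \<in> Cmeas" "AE t in circ. f (cis t) = g (cis t)"
  shows "g \<in> L2"
proof -
  have "integrable circ (\<lambda>t. (cmod (g (cis t)))\<^sup>2)"
  proof (rule integrable_cong_AE_imp)
    show "integrable circ (\<lambda>t. (cmod (f (cis t)))\<^sup>2)" using assms by (simp add: L2_iff)
    show "(\<lambda>t. (cmod (g (cis t)))\<^sup>2) \<in> borel_measurable circ" using assms(2) unfolding Cmeas_def by simp
    show "AE t in circ. (cmod (f (cis t)))\<^sup>2 = (cmod (g (cis t)))\<^sup>2" using assms(3) by auto
  qed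
  with assms show ?thesis by (simp add: L2_iff)
qed

text \<open>Elements of the model space agree almost everywhere with bounded combinations of
  kernels, so multiplication by \<phi> is defined on the whole model space.\<close>

lemma K2_blaschke_mult_L2:
  assumes as: "\<forall>a\<in>set as. cmod a < 1" "distinct as" and f: "f \<in> K2 (blaschke \<gamma> as)" and \<phi>: "\<phi> \<in> L2"
  shows "(\<lambda>z. \<phi> z * f z) \<in> L2"
proof -
  obtain c where c: "l2eq f (\<lambda>z. \<Sum>l\<in>set as. c l * szego l z)" (is "l2eq f ?g")
    using K2_blaschke_span[OF as f] .
  have g: "?g \<in> Linf" using Linf_span[OF as(1)] .
  show ?thesis
  proof (rule L2_cong_AE)
    show "(\<lambda>z. ?g z * \<phi> z) \<in> L2" using g \<phi> by (rule L2_bounded_mult)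
    show "(\<lambda>z. \<phi> z * f z) \<in> Cmeas" using \<phi> K2_imp_L2[OF f] by (intro Cmeas_mult L2_imp_Cmeas)
    show "AE t in circ. ?g (cis t) * \<phi> (cis t) = \<phi> (cis t) * f (cis t)"
      using c l2eq_iff_AE[OF K2_imp_L2[OF f] Linf_imp_L2[OF g]] by auto
  qed
qed

section \<open>From a symbol to symmetric compressions\<close>

lemma TTO_imp_C_symmetric:
  assumes as: "\<forall>a\<in>set as. cmod a < 1" "distinct as"
    and A: "\<forall>f\<in>K2 (blaschke \<gamma> as). A f \<in> K2 (blaschke \<gamma> as)" and tto: "TTO (blaschke \<gamma> as) A"
    and bs: "\<forall>b\<in>set bs. cmod b < 1"
    and sub: "K2 (blaschke \<delta> bs) \<subseteq> K2 (blaschke \<gamma> as)"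
  shows "C_symmetric (blaschke \<delta> bs) (\<lambda>f. proj_onto (K2 (blaschke \<delta> bs)) (A f))"
proof -
  let ?B = "blaschke \<gamma> as" and ?b = "blaschke \<delta> bs"
  note b = Mult_blaschke[OF bs, of \<delta>] blaschke_unimodular[OF bs, of \<delta>]
  obtain \<phi> where \<phi>: "\<phi> \<in> L2"
    and A\<phi>: "\<And>f. f \<in> K2 ?B \<Longrightarrow> (\<lambda>z. \<phi> z * f z) \<in> L2 \<Longrightarrow> l2eq (A f) (Pth ?B (\<lambda>z. \<phi> z * f z))"
    using tto unfolding TTO_def by blast
  \<comment> \<open>The projection onto the large space disappears against its elements, so in inner
    products \<open>A\<close> acts as multiplication by \<phi>.\<close>
  have iA: "ipr (A f) g = ipr (\<lambda>z. \<phi> z * f z) g" if f: "f \<in> K2 ?B" and g: "g \<in> K2 ?B" for f g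
  proof -
    have L: "(\<lambda>z. \<phi> z * f z) \<in> L2" using as f \<phi> by (rule K2_blaschke_mult_L2)
    have hp: "has_proj (K2 ?B) (\<lambda>z. \<phi> z * f z)" using as L by (rule has_proj_blaschke)
    have "ipr (A f) g = ipr (proj_onto (K2 ?B) (\<lambda>z. \<phi> z * f z)) g"
      using A\<phi>[OF f L] A f g proj_onto_props(1)[OF hp] by (intro ipr_l2eq) (auto simp: Pth_def K2_imp_L2)
    also have "\<dots> = ipr (\<lambda>z. \<phi> z * f z) g" using hp L g by (rule ipr_proj_onto)
    finally show ?thesis .
  qed
  \<comment> \<open>The expansion uses kernels at the distinct zeros \<open>as\<close> of the larger
    product, since \<open>bs\<close> may repeat zeros.\<close>
  have C: "Cth ?b f \<in> K2 ?b" if f: "f \<in> K2 ?b" for f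
  proof -
    obtain c where "l2eq f (\<lambda>z. \<Sum>l\<in>set as. c l * szego l z)"
      using K2_blaschke_span[OF as] f sub by blast
    then show ?thesis using Cth_in_K2[OF b as(1) f] by blast
  qed
  have P: "A f \<in> L2 \<and> has_proj (K2 ?b) (A f)" if f: "f \<in> K2 ?b" for f
  proof -
    have Af: "A f \<in> K2 ?B" using f sub A by auto
    obtain c where "l2eq (A f) (\<lambda>z. \<Sum>l\<in>set as. c l * szego l z)"
      using K2_blaschke_span[OF as Af] .
    then show ?thesis using has_proj_span[OF b as(1) K2_imp_L2[OF Af]] K2_imp_L2[OF Af] by blast
  qed
  have iff: "C_symmetric ?b (\<lambda>f. proj_onto (K2 ?b) (A f)) \<longleftrightarrow>
      (\<forall>f\<in>K2 ?b. \<forall>g\<in>K2 ?b. ipr (A (Cth ?b f)) (Cth ?b g) = ipr (A g) f)"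
    using C P by (rule C_symmetric_iff)
  show ?thesis
    unfolding iff
  proof (intro ballI)
    fix f g assume f: "f \<in> K2 ?b" and g: "g \<in> K2 ?b"
    \<comment> \<open>The factors \<open>?b z\<close> and \<open>z\<close> each meet their
      conjugate, and conjugation swaps the roles of \<open>f\<close> and \<open>g\<close>.\<close>
    have pw: "\<phi> z * Cth ?b f z * cnj (Cth ?b g z) = \<phi> z * g z * cnj (f z)" if z: "cmod z = 1" for z
    proof -
      have "\<phi> z * Cth ?b f z * cnj (Cth ?b g z)
          = ?b z * (cnj (?b z) * ((z * cnj z) * (\<phi> z * g z * cnj (f z))))"
        by (simp add: Cth_def mult_ac)
      then show ?thesis using unimodularD[OF b(2) z] unit_mult_cnj[OF z] by simp
    qed
    have "ipr (A (Cth ?b f)) (Cth ?b g) = ipr (\<lambda>z. \<phi> z * Cth ?b f z) (Cth ?b g)"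
      using C[OF f] C[OF g] sub by (intro iA) auto
    also have "\<dots> = ipr (\<lambda>z. \<phi> z * g z) f"
      unfolding ipr_def by (simp only: pw[OF norm_cis])
    also have "\<dots> = ipr (A g) f" using f g sub by (intro iA[symmetric]) auto
    finally show "ipr (A (Cth ?b f)) (Cth ?b g) = ipr (A g) f" .
  qed
qed


section \<open>From symmetric compressions to a symbol\<close>

lemma lin_op_ipr_sum:
  assumes A: "lin_op_on (K2 \<theta>) A" and \<theta>: "\<theta> \<in> Mult" and I: "finite I"
    and f: "\<And>i. i \<in> I \<Longrightarrow> f i \<in> K2 \<theta>" and h: "h \<in> L2"
  shows "ipr (A (\<lambda>z. \<Sum>i\<in>I. c i * f i z)) h = (\<Sum>i\<in>I. c i * ipr (A (f i)) h)"
proof -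
  have AK: "A g \<in> L2" if "g \<in> K2 \<theta>" for g using A that by (auto simp: lin_op_on_def K2_imp_L2)
  \<comment> \<open>\<open>A\<close> is linear only up to \<open>l2eq\<close>, so linearity is used
    inside inner products, which respect this relation.\<close>
  have scale: "ipr (A (\<lambda>z. c * g z)) h = c * ipr (A g) h" if g: "g \<in> K2 \<theta>" for c g
  proof -
    have "l2eq (A (\<lambda>z. c * g z)) (\<lambda>z. c * A g z)" using A g by (simp add: lin_op_on_def)
    then have "ipr (A (\<lambda>z. c * g z)) h = ipr (\<lambda>z. c * A g z) h"
      using g h by (intro ipr_l2eq) (auto simp: AK K2_cmult L2_cmult)
    then show ?thesis by (simp add: ipr_cmult_left)
  qed
  have plus: "ipr (A (\<lambda>z. g z + g' z)) h = ipr (A g) h + ipr (A g') h"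
    if g: "g \<in> K2 \<theta>" "g' \<in> K2 \<theta>" for g g'
  proof -
    have "l2eq (A (\<lambda>z. g z + g' z)) (\<lambda>z. A g z + A g' z)" using A g by (simp add: lin_op_on_def)
    then have "ipr (A (\<lambda>z. g z + g' z)) h = ipr (\<lambda>z. A g z + A g' z) h"
      using g h \<theta> by (intro ipr_l2eq) (auto simp: AK K2_add L2_add)
    then show ?thesis using g h by (simp add: ipr_add_left AK)
  qed
  have zero: "(\<lambda>z. 0) \<in> K2 \<theta>" using K2_sum[OF \<theta>, of "{}"] by simp
  show ?thesis
    using I f
  proof (induction I rule: finite_induct)
    case empty
    then show ?case using scale[OF zero, of 0] by simp
  next
    case (insert i I)
    then show ?case using \<theta> by (simp add: plus scale K2_cmult K2_sum)
  qed
qed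

text \<open>Pythagoras: \<open>f\<close> splits into the orthogonal parts \<open>f - g\<close> and
  \<open>g\<close>, so the squared norms add.\<close>

lemma l2norm_le_of_orthogonal:
  assumes "f \<in> L2" "g \<in> L2" "ipr (\<lambda>z. f z - g z) g = 0"
  shows "l2norm g \<le> l2norm f"
proof -
  let ?d = "\<lambda>z. f z - g z"
  have d: "?d \<in> L2" using assms by (simp add: L2_diff)
  have gd: "ipr g ?d = 0" using assms(3) ipr_cnj[of g ?d] by simp
  have split: "ipr f h = ipr ?d h + ipr g h" if "h \<in> L2" for h
    using that assms by (simp add: ipr_diff_left)
  have "ipr f f = ipr ?d f + ipr g f" using split[OF assms(1)] .
  moreover have "ipr ?d f = ipr ?d ?d"
  proof -
    have "ipr f ?d = ipr ?d ?d" using split[OF d] gd by simp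
    then have "ipr ?d f = cnj (ipr ?d ?d)" using ipr_cnj[of ?d f] by (rule subst)
    then show ?thesis using ipr_cnj[of ?d ?d] by metis
  qed
  moreover have "ipr g f = ipr g g"
  proof -
    have "ipr f g = ipr g g" using split[OF assms(2)] assms(3) by simp
    then have "ipr g f = cnj (ipr g g)" using ipr_cnj[of g f] by (rule subst)
    then show ?thesis using ipr_cnj[of g g] by metis
  qed
  ultimately have "complex_of_real ((l2norm f)\<^sup>2) = complex_of_real ((l2norm ?d)\<^sup>2 + (l2norm g)\<^sup>2)"
    using assms d by (simp add: ipr_self)
  then have "(l2norm f)\<^sup>2 = (l2norm ?d)\<^sup>2 + (l2norm g)\<^sup>2" by (simp only: of_real_eq_iff)
  then have "(l2norm g)\<^sup>2 \<le> (l2norm f)\<^sup>2" by simp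
  then show ?thesis using l2norm_nonneg[OF assms(1)] by (rule power2_le_imp_le)
qed

lemma l2norm_bounded_mult:
  assumes "F \<in> Linf"
  obtains C where "\<And>f. f \<in> L2 \<Longrightarrow> l2norm (\<lambda>z. F z * f z) \<le> C * l2norm f"
proof -
  obtain C0 where C0: "\<And>z. cmod z = 1 \<Longrightarrow> cmod (F z) \<le> C0" using assms by (auto simp: Linf_def)
  have "0 \<le> C0" using C0[of 1] norm_ge_zero[of "F 1"] by (simp del: norm_ge_zero)
  have "l2norm (\<lambda>z. F z * f z) \<le> C0 * l2norm f" if f: "f \<in> L2" for f
  proof -
    have Ff: "(\<lambda>z. F z * f z) \<in> L2" using assms f by (rule L2_bounded_mult)
    have "(LINT t|circ. (cmod (F (cis t) * f (cis t)))\<^sup>2) \<le> (LINT t|circ. C0\<^sup>2 * (cmod (f (cis t)))\<^sup>2)"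
      using f Ff C0 by (intro integral_mono)
        (auto simp: L2_iff norm_mult power_mult_distrib intro!: mult_right_mono power_mono)
    then have "(LINT t|circ. (cmod (F (cis t) * f (cis t)))\<^sup>2) / (2 * pi)
        \<le> C0\<^sup>2 * ((LINT t|circ. (cmod (f (cis t)))\<^sup>2) / (2 * pi))"
      by (simp add: divide_right_mono)
    then have "l2norm (\<lambda>z. F z * f z) \<le> sqrt (C0\<^sup>2 * ((LINT t|circ. (cmod (f (cis t)))\<^sup>2) / (2 * pi)))"
      using Ff by (simp add: l2norm_eq)
    also have "\<dots> = C0 * l2norm f" unfolding real_sqrt_mult using f \<open>0 \<le> C0\<close> by (simp add: l2norm_eq)
    finally show ?thesis .
  qed
  then show ?thesis using that by blast
qed

lemma ev_span_mult_szego: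
  assumes "\<forall>a\<in>S. cmod a < 1" "cmod i < 1" "cmod j < 1"
  shows "ev j (\<lambda>z. (\<Sum>l\<in>S. c l * szego l z) * szego i z) = (\<Sum>l\<in>S. c l * szego l j) * szego i j"
proof -
  have L: "(\<lambda>z. szego l z * szego i z) \<in> L2" if "l \<in> S" for l
    using that assms by (intro H2_imp_L2 H2_szego_mult H2_szego) auto
  have "ev j (\<lambda>z. (\<Sum>l\<in>S. c l * szego l z) * szego i z) = ev j (\<lambda>z. \<Sum>l\<in>S. c l * (szego l z * szego i z))"
    by (simp add: sum_distrib_right mult.assoc)
  also have "\<dots> = (\<Sum>l\<in>S. c l * ev j (\<lambda>z. szego l z * szego i z))"
    using L assms by (simp add: ev_eq_ipr L2_sum L2_cmult ipr_sum_left L2_szego)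
  also have "\<dots> = (\<Sum>l\<in>S. c l * (szego l j * szego i j))"
    using assms by (intro sum.cong refl) (simp add: ev_szego_mult H2_szego ev_szego)
  finally show ?thesis by (simp add: sum_distrib_right mult.assoc)
qed

text \<open>The symbol is \<open>cnj p + q\<close> where \<open>p\<close> and \<open>q\<close> interpolate \<open>cnj u\<close> and \<open>v\<close>.\<close>

lemma exists_symbol:
  assumes S: "finite S" "\<forall>a\<in>S. cmod a < 1"
  obtains \<phi> where "\<phi> \<in> Linf"
    "\<And>i j. i \<in> S \<Longrightarrow> j \<in> S \<Longrightarrow> ipr (\<lambda>z. \<phi> z * szego i z) (szego j) = (u i + v j) * szego i j"
proof -
  obtain c where c: "\<forall>i\<in>S. (\<Sum>l\<in>S. c l * szego l i) = cnj (u i)"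
    using szego_interpolation[OF S, of "\<lambda>i. cnj (u i)"] by blast
  obtain d where d: "\<forall>i\<in>S. (\<Sum>l\<in>S. d l * szego l i) = v i"
    using szego_interpolation[OF S, of v] by blast
  define p where "p = (\<lambda>z. \<Sum>l\<in>S. c l * szego l z)"
  define q where "q = (\<lambda>z. \<Sum>l\<in>S. d l * szego l z)"
  have pq: "p \<in> Linf" "q \<in> Linf" unfolding p_def q_def using S by (auto intro: Linf_span)
  show ?thesis
  proof (rule that[of "\<lambda>z. cnj (p z) + q z"])
    show "(\<lambda>z. cnj (p z) + q z) \<in> Linf" using Linf_add[OF Linf_cnj[OF pq(1)] pq(2)] .
    fix i j assume i: "i \<in> S" and j: "j \<in> S"
    have k: "cmod i < 1" "cmod j < 1" using i j S by auto
    have L: "(\<lambda>z. cnj (p z) * szego i z) \<in> L2" "(\<lambda>z. q z * szego i z) \<in> L2" "(\<lambda>z. p z * szego j z) \<in> L2"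
      using pq k by (auto intro!: L2_bounded_mult Linf_cnj L2_szego)
    have "ipr (\<lambda>z. (cnj (p z) + q z) * szego i z) (szego j)
        = ipr (\<lambda>z. cnj (p z) * szego i z) (szego j) + ipr (\<lambda>z. q z * szego i z) (szego j)"
      using L k by (simp add: distrib_right ipr_add_left L2_szego)
    \<comment> \<open>Moved to the second slot, \<open>cnj p\<close> becomes \<open>p\<close>, and
      the inner product is the conjugate of a value at \<open>i\<close>; hence \<open>p\<close>
      interpolates \<open>cnj u\<close>.\<close>
    also have "ipr (\<lambda>z. cnj (p z) * szego i z) (szego j) = ipr (szego i) (\<lambda>z. p z * szego j z)"
      by (simp add: ipr_def mult_ac)
    also have "\<dots> = cnj (ev i (\<lambda>z. p z * szego j z))" using L k by (simp add: ipr_szego)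
    also have "\<dots> = u i * szego i j"
      unfolding p_def using S k c i by (simp add: ev_span_mult_szego cnj_szego)
    also have "ipr (\<lambda>z. q z * szego i z) (szego j) = ev j (\<lambda>z. q z * szego i z)"
      using L k by (simp add: ev_eq_ipr)
    also have "\<dots> = v j * szego i j"
      unfolding q_def using S k d j by (simp add: ev_span_mult_szego)
    finally show "ipr (\<lambda>z. (cnj (p z) + q z) * szego i z) (szego j) = (u i + v j) * szego i j"
      by (simp add: distrib_right)
  qed
qed

lemma C_symmetric_imp_symmetry_relation:
  assumes as: "\<forall>a\<in>set as. cmod a < 1" "distinct as"
    and A: "lin_op_on (K2 (blaschke \<gamma> as)) A"
    and bs: "\<forall>a\<in>set bs. cmod a < 1" "distinct bs"
    and sub: "K2 (blaschke 0 bs) \<subseteq> K2 (blaschke \<gamma> as)"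
    and sym: "C_symmetric (blaschke 0 bs) (\<lambda>f. proj_onto (K2 (blaschke 0 bs)) (A f))"
  shows "symmetry_relation (set bs) (\<lambda>i l. ipr (A (szego i)) (szego l) * (1 - cnj i * l))"
proof -
  let ?B = "blaschke \<gamma> as" and ?b = "blaschke 0 bs" and ?S = "set bs"
  note b = Mult_blaschke[OF bs(1), of 0] blaschke_unimodular[OF bs(1), of 0]
  have AK: "A f \<in> K2 ?B" if "f \<in> K2 ?B" for f using A that by (simp add: lin_op_on_def)
  have C: "Cth ?b f \<in> K2 ?b" if f: "f \<in> K2 ?b" for f
  proof -
    obtain c where "l2eq f (\<lambda>z. \<Sum>l\<in>?S. c l * szego l z)"
      using K2_blaschke_span[OF bs f] .
    then show ?thesis using Cth_in_K2[OF b bs(1) f] by blast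
  qed
  have P: "A f \<in> L2 \<and> has_proj (K2 ?b) (A f)" if f: "f \<in> K2 ?b" for f
    using has_proj_blaschke[OF bs] K2_imp_L2[OF AK] f sub by blast
  have iff: "C_symmetric ?b (\<lambda>f. proj_onto (K2 ?b) (A f)) \<longleftrightarrow>
      (\<forall>f\<in>K2 ?b. \<forall>g\<in>K2 ?b. ipr (A (Cth ?b f)) (Cth ?b g) = ipr (A g) f)"
    using C P by (rule C_symmetric_iff)
  have rel: "ipr (A (Cth ?b f)) (Cth ?b g) = ipr (A g) f" if "f \<in> K2 ?b" "g \<in> K2 ?b" for f g
    using sym that unfolding iff by blast
  have k: "szego i \<in> K2 ?b" if "i \<in> ?S" for i using bs that by (simp add: szego_in_K2_blaschke)
  \<comment> \<open>Partial fractions bring in \<open>szego j l\<close>; inserting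
    \<open>szego i l * (1 - cnj i * l) = 1\<close> produces the matrix entry with weights symmetric
    in \<open>i\<close> and \<open>j\<close>.\<close>
  have expand: "ipr (A (szego i)) (Cth ?b (szego j))
     = (\<Sum>l\<in>?S. cnj (pf_coeff ?S l) * szego j l * szego i l * (ipr (A (szego i)) (szego l) * (1 - cnj i * l)))"
    if i: "i \<in> ?S" and j: "j \<in> ?S" for i j
  proof -
    have "ipr (A (szego i)) (Cth ?b (szego j))
        = ipr (A (szego i)) (\<lambda>z. \<Sum>l\<in>?S. pf_coeff ?S l / (1 - j * cnj l) * szego l z)"
      using bs j by (intro ipr_cong) (simp_all add: Cth_szego dual_fun_partial_fraction)
    also have "\<dots> = (\<Sum>l\<in>?S. cnj (pf_coeff ?S l / (1 - j * cnj l)) * ipr (A (szego i)) (szego l))"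
      using bs i k sub by (intro ipr_sum_right) (auto simp: L2_szego intro!: K2_imp_L2[OF AK])
    also have "\<dots> = (\<Sum>l\<in>?S. cnj (pf_coeff ?S l) * szego j l * szego i l
        * (ipr (A (szego i)) (szego l) * (1 - cnj i * l)))"
    proof (intro sum.cong refl)
      fix l assume l: "l \<in> ?S"
      have "1 - cnj i * l \<noteq> 0" using bs i l szego_denom_nonzero[of i l] by (simp add: less_imp_le)
      then show "cnj (pf_coeff ?S l / (1 - j * cnj l)) * ipr (A (szego i)) (szego l)
         = cnj (pf_coeff ?S l) * szego j l * szego i l * (ipr (A (szego i)) (szego l) * (1 - cnj i * l))"
        by (simp add: szego_def)
    qed
    finally show ?thesis .
  qed
  show ?thesis
    unfolding symmetry_relation_def
  proof (intro ballI)
    fix i j assume i: "i \<in> ?S" and j: "j \<in> ?S"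
    \<comment> \<open>The symmetry is tested on \<open>Cth ?b (szego i)\<close> and
      \<open>szego j\<close>. Double conjugation restores \<open>szego i\<close> only on the circle,
      so the compatibility of \<open>A\<close> with \<open>l2eq\<close> is used.\<close>
    have CC: "l2eq (Cth ?b (Cth ?b (szego i))) (szego i)"
      using Cth_Cth[OF b(2)] by (intro l2eq_on_circle)
    have in_B: "Cth ?b (Cth ?b (szego i)) \<in> K2 ?B" "szego i \<in> K2 ?B" "Cth ?b (szego j) \<in> L2"
      using k[OF i] k[OF j] C sub K2_imp_L2 by blast+
    then have "l2eq (A (Cth ?b (Cth ?b (szego i)))) (A (szego i))"
      using A CC by (simp add: lin_op_on_def)
    then have "ipr (A (szego i)) (Cth ?b (szego j)) = ipr (A (Cth ?b (Cth ?b (szego i)))) (Cth ?b (szego j))"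
      using in_B K2_imp_L2[OF AK] by (intro ipr_l2eq[symmetric]) auto
    also have "\<dots> = ipr (A (szego j)) (Cth ?b (szego i))"
      using k[OF i] k[OF j] C by (intro rel) auto
    finally show "(\<Sum>l\<in>?S. cnj (pf_coeff ?S l) * szego j l * szego i l * (ipr (A (szego i)) (szego l) * (1 - cnj i * l)))
      = (\<Sum>l\<in>?S. cnj (pf_coeff ?S l) * szego i l * szego j l * (ipr (A (szego j)) (szego l) * (1 - cnj j * l)))"
      unfolding expand[OF i j] expand[OF j i] .
  qed
qed

text \<open>The symbol is built to match \<open>A\<close> on pairs of kernels; these span the model
  space and their evaluations separate it.\<close>

lemma additive_imp_TTO:
  assumes as: "\<forall>a\<in>set as. cmod a < 1" "distinct as"
    and A: "lin_op_on (K2 (blaschke \<gamma> as)) A"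
    and uv: "\<And>i l. i \<in> set as \<Longrightarrow> l \<in> set as \<Longrightarrow> ipr (A (szego i)) (szego l) * (1 - cnj i * l) = u i + v l"
  shows "TTO (blaschke \<gamma> as) A"
proof -
  let ?B = "blaschke \<gamma> as" and ?S = "set as"
  obtain \<phi> where \<phi>: "\<phi> \<in> Linf"
    and sym: "\<And>i j. i \<in> ?S \<Longrightarrow> j \<in> ?S \<Longrightarrow> ipr (\<lambda>z. \<phi> z * szego i z) (szego j) = (u i + v j) * szego i j"
    using exists_symbol[of ?S u v] as by auto
  have AK: "A f \<in> K2 ?B" if "f \<in> K2 ?B" for f using A that by (simp add: lin_op_on_def)
  have L: "(\<lambda>z. \<phi> z * f z) \<in> L2" if "f \<in> K2 ?B" for f
    using \<phi> K2_imp_L2[OF that] by (rule L2_bounded_mult)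
  have hp: "has_proj (K2 ?B) (\<lambda>z. \<phi> z * f z)" if "f \<in> K2 ?B" for f
    using as L[OF that] by (rule has_proj_blaschke)
  have P: "Pth ?B (\<lambda>z. \<phi> z * f z) \<in> K2 ?B" if "f \<in> K2 ?B" for f
    using proj_onto_props(1)[OF hp[OF that]] by (simp add: Pth_def)
  have k: "szego i \<in> K2 ?B" if "i \<in> ?S" for i using as that by (simp add: szego_in_K2_blaschke)
  have basis: "ipr (A (szego i)) (szego j) = ipr (\<lambda>z. \<phi> z * szego i z) (szego j)" if "i \<in> ?S" "j \<in> ?S" for i j
  proof -
    have "1 - cnj i * j \<noteq> 0" using as that szego_denom_nonzero[of i j] by (simp add: less_imp_le)
    then have "ipr (A (szego i)) (szego j) = (u i + v j) * szego i j"
      using uv[OF that] by (simp add: szego_def eq_divide_eq)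
    then show ?thesis using sym[OF that] by simp
  qed
  have eq: "ipr (A f) (szego j) = ipr (\<lambda>z. \<phi> z * f z) (szego j)" if f: "f \<in> K2 ?B" and j: "j \<in> ?S" for f j
  proof -
    obtain c where c: "l2eq f (\<lambda>z. \<Sum>l\<in>?S. c l * szego l z)" (is "l2eq f ?g")
      using K2_blaschke_span[OF as f] .
    have g: "?g \<in> K2 ?B" using as k by (intro K2_sum Mult_blaschke) auto
    have kj: "szego j \<in> L2" using K2_imp_L2[OF k[OF j]] .
    have "l2eq (A f) (A ?g)" using A c f g by (simp add: lin_op_on_def)
    then have "ipr (A f) (szego j) = ipr (A ?g) (szego j)"
      using AK f g kj by (intro ipr_l2eq) (auto intro: K2_imp_L2)
    also have "\<dots> = (\<Sum>l\<in>?S. c l * ipr (A (szego l)) (szego j))"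
      using as k kj by (intro lin_op_ipr_sum[OF A] Mult_blaschke) auto
    also have "\<dots> = (\<Sum>l\<in>?S. c l * ipr (\<lambda>z. \<phi> z * szego l z) (szego j))"
      using j by (simp add: basis)
    also have "\<dots> = ipr (\<lambda>z. \<Sum>l\<in>?S. c l * (\<phi> z * szego l z)) (szego j)"
      using L k kj by (intro ipr_sum_left[symmetric]) auto
    also have "\<dots> = ipr (\<lambda>z. \<phi> z * ?g z) (szego j)"
      by (simp add: sum_distrib_left mult.left_commute)
    also have "\<dots> = ipr (\<lambda>z. \<phi> z * f z) (szego j)"
    proof (rule ipr_l2eq)
      show "l2eq (\<lambda>z. \<phi> z * ?g z) (\<lambda>z. \<phi> z * f z)"
        using c l2eq_iff_AE[OF K2_imp_L2[OF f] K2_imp_L2[OF g]] l2eq_iff_AE[OF L[OF g] L[OF f]] by auto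
    qed (use L f g kj in auto)
    finally show ?thesis .
  qed
  have AP: "l2eq (A f) (Pth ?B (\<lambda>z. \<phi> z * f z))" if f: "f \<in> K2 ?B" for f
    unfolding l2eq_def
  proof (rule K2_blaschke_eq_0[OF as])
    show "(\<lambda>z. A f z - Pth ?B (\<lambda>z. \<phi> z * f z) z) \<in> K2 ?B"
      using f as by (intro K2_diff Mult_blaschke AK P)
    show "\<forall>a\<in>?S. ev a (\<lambda>z. A f z - Pth ?B (\<lambda>z. \<phi> z * f z) z) = 0"
    proof
      fix a assume a: "a \<in> ?S"
      have "ipr (Pth ?B (\<lambda>z. \<phi> z * f z)) (szego a) = ipr (\<lambda>z. \<phi> z * f z) (szego a)"
        unfolding Pth_def using hp[OF f] L[OF f] k[OF a] by (rule ipr_proj_onto)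
      then show "ev a (\<lambda>z. A f z - Pth ?B (\<lambda>z. \<phi> z * f z) z) = 0"
        using a as f eq[OF f a] K2_imp_L2[OF AK[OF f]] K2_imp_L2[OF P[OF f]] by (simp add: ev_diff ev_eq_ipr)
    qed
  qed
  \<comment> \<open>The symbol is bounded and the projection contractive, which bounds the
    compression; \<open>A\<close> inherits this bound.\<close>
  obtain C where C: "\<And>f. f \<in> L2 \<Longrightarrow> l2norm (\<lambda>z. \<phi> z * f z) \<le> C * l2norm f"
    using l2norm_bounded_mult[OF \<phi>] by blast
  have bound: "l2norm (Pth ?B (\<lambda>z. \<phi> z * f z)) \<le> C * l2norm f" if f: "f \<in> K2 ?B" for f
  proof -
    have "l2norm (Pth ?B (\<lambda>z. \<phi> z * f z)) \<le> l2norm (\<lambda>z. \<phi> z * f z)"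
      using L[OF f] K2_imp_L2[OF P[OF f]] proj_onto_props(2)[OF hp[OF f] P[OF f]]
      by (intro l2norm_le_of_orthogonal) (auto simp: Pth_def)
    then show ?thesis using C[OF K2_imp_L2[OF f]] by linarith
  qed
  have "l2norm (A f) \<le> C * l2norm f" if f: "f \<in> K2 ?B" for f
    using bound[OF f] l2norm_l2eq[OF AP[OF f] K2_imp_L2[OF AK[OF f]] K2_imp_L2[OF P[OF f]]] by simp
  then show ?thesis
    unfolding TTO_def using \<phi> bound AP Linf_imp_L2 by blast
qed

theorem theorem4p3:
  fixes \<gamma> :: real and as :: "complex list" and N :: nat
    and A :: "(complex \<Rightarrow> complex) \<Rightarrow> (complex \<Rightarrow> complex)"
  assumes "length as = N" and "distinct as" and "\<forall>a\<in>set as. cmod a < 1"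
    and "lin_op_on (K2 (blaschke \<gamma> as)) A"
  shows "(TTO (blaschke \<gamma> as) A
           \<longleftrightarrow> (\<forall>B\<sigma>. is_finite_blaschke B\<sigma> \<and> nonconstant_on_disc B\<sigma> \<and>
                      divides_inner B\<sigma> (blaschke \<gamma> as) \<longrightarrow>
                  C_symmetric B\<sigma> (\<lambda>f. proj_onto (K2 B\<sigma>) (A f))))
       \<and> (TTO (blaschke \<gamma> as) A
           \<longleftrightarrow> (\<forall>n\<in>{1..N}. C_symmetric (blaschke 0 (take n as))
                  (\<lambda>f. proj_onto (K2 (blaschke 0 (take n as))) (A f))))"
    (is "(?TTO \<longleftrightarrow> ?all) \<and> (?TTO \<longleftrightarrow> ?chain)")
proof -
  note as = assms(3) assms(2)
  have take: "\<forall>a\<in>set (take n as). cmod a < 1" for n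
    using as set_take_subset[of n as] by auto
  \<comment> \<open>Three implications in a cycle give both equivalences.\<close>
  have "?TTO \<Longrightarrow> ?all"
  proof (intro allI impI)
    fix B\<sigma> assume tto: ?TTO
      and "is_finite_blaschke B\<sigma> \<and> nonconstant_on_disc B\<sigma> \<and> divides_inner B\<sigma> (blaschke \<gamma> as)"
    then obtain \<delta> bs where bs: "\<forall>b\<in>set bs. cmod b < 1" "B\<sigma> = blaschke \<delta> bs"
      and dvd: "divides_inner (blaschke \<delta> bs) (blaschke \<gamma> as)"
      by (auto simp: is_finite_blaschke_def)
    have "\<forall>f\<in>K2 (blaschke \<gamma> as). A f \<in> K2 (blaschke \<gamma> as)" using assms(4) by (simp add: lin_op_on_def)
    then show "C_symmetric B\<sigma> (\<lambda>f. proj_onto (K2 B\<sigma>) (A f))"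
      unfolding bs(2) using as tto bs(1) K2_subset_divides[OF as(1) bs(1) dvd]
      by (intro TTO_imp_C_symmetric)
  qed
  moreover have "?all \<Longrightarrow> ?chain"
  proof
    fix n assume all: ?all and n: "n \<in> {1..N}"
    have "is_finite_blaschke (blaschke 0 (take n as))" using take by (auto simp: is_finite_blaschke_def)
    \<comment> \<open>The index starts at 1, so the prefix is nonempty and the divisor
      nonconstant.\<close>
    moreover have "take n as \<noteq> []" using n assms(1) by auto
    then have "nonconstant_on_disc (blaschke 0 (take n as))" using take by (intro blaschke_nonconstant)
    ultimately show "C_symmetric (blaschke 0 (take n as))
        (\<lambda>f. proj_onto (K2 (blaschke 0 (take n as))) (A f))"
      using all blaschke_take_divides[OF as(1)] by blast
  qed
  moreover have "?chain \<Longrightarrow> ?TTO"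
  proof -
    assume chain: ?chain
    define M where "M i l = ipr (A (szego i)) (szego l) * (1 - cnj i * l)" for i l
    have "symmetry_relation (set (take n as)) M" if "n \<in> {1..length as}" for n
      unfolding M_def
      using chain that assms(1) as take
      by (intro C_symmetric_imp_symmetry_relation[OF as assms(4)]
          K2_subset_divides blaschke_take_divides) auto
    then obtain u v where "\<forall>i\<in>set as. \<forall>l\<in>set as. M i l = u i + v l"
      using additive_structure[OF as, of M] by blast
    then show ?TTO using additive_imp_TTO[OF as assms(4), of u v] by (simp add: M_def)
  qed
  ultimately show ?thesis by blast
qed

end
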